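(* Let $(s_n)_{n\ge 1}$ be the increasing enumeration of $S=\{2^j3^k : j,k\in\mathbb{Z}_{\ge 0}\}$, and let $\mu$ be an $S$-invariant and $S$-ergodic probability measure on $\mathbb{T}=\mathbb{R}/\mathbb{Z}$. If $f:\mathbb{T}\to\mathbb{C}$ is a measurable function in $L\log^+L$, i.e. $\int_{\mathbb{T}}|f|\log^+|f|\,d\mu<\infty$, then $$\frac1N\sum_{n\le N}f(s_nx)\ \longrightarrow\ \int_{\mathbb{T}} f\,d\mu\qquad\text{as } N\to\infty,\ \text{ for }\mu\text{-a.e. } x.$$ In particular, for $\mu$-a.e. $x$, $\frac1N\sum_{n\le N}\delta_{s_nx}\to\mu$ in the weak$^*$ topology. Consequently, if Furstenberg's conjecture were not correct, there would exist an $S$-invariant probability measure $\mu$ carried by $W(S)$, i.e. with $\mu(W(S))=1$.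
   Context: For an integer $q\ge 1$, $\sigma_q:\mathbb{T}\to\mathbb{T}$ is the map $x\mapsto qx \bmod 1$. A probability measure $\mu$ on $\mathbb{T}$ is $S$-invariant if it is invariant under both $\sigma_2$ and $\sigma_3$ (equivalently $\widehat\mu(sn)=\widehat\mu(n)$ for all $s\in S$, $n\in\mathbb{Z}$). An $S$-invariant probability measure $\mu$ is $S$-ergodic if every measurable $h$ satisfying both $h\circ\sigma_2=h$ and $h\circ\sigma_3=h$ ($\mu$-a.e.) is constant $\mu$-a.e. $W(S)$ denotes the set of $x\in\mathbb{T}$ such that $(s_nx)_{n\ge1}$ is not equidistributed modulo 1. Furstenberg's conjecture is the assertion that every continuous (atomless) $S$-invariant probability measure on $\mathbb{T}$ is the Lebesgue (Haar) measure. *)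

theory Defs
  imports "HOL-Probability.Probability" "HOL-Library.Infinite_Set"
begin

text \<open>The circle \<open>\<real>/\<int>\<close> is represented by its fundamental domain \<open>{0..<1}\<close>. The Borel
  sets of the quotient correspond to the Borel subsets of \<open>{0..<1}\<close>. The topology is not the
  subspace topology: continuous functions on the circle are the continuous functions on the line
  that have period 1.\<close>

definition circle_borel :: "real measure" where
  "circle_borel = restrict_space borel {0..<1}"

definition circle_lebesgue :: "real measure" where
  "circle_lebesgue = restrict_space lborel {0..<1}"

definition circle_continuous :: "(real \<Rightarrow> complex) \<Rightarrow> bool" where
  "circle_continuous g \<longleftrightarrow> continuous_on UNIV g \<and> (\<forall>x. g (x + 1) = g x)"

definition sigma_map :: "nat \<Rightarrow> real \<Rightarrow> real" where
  "sigma_map q x = frac (real q * x)"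

definition S :: "nat set" where
  "S = {2 ^ j * 3 ^ k | j k. True}"

lemma infinite_S: "infinite S"
proof -
  have "range (\<lambda>j. 2 ^ j :: nat) \<subseteq> S"
  proof
    fix m :: nat
    assume "m \<in> range (\<lambda>j. 2 ^ j)"
    then obtain j where "m = 2 ^ j * 3 ^ (0::nat)" by auto
    then show "m \<in> S" unfolding S_def by blast
  qed
  moreover have "infinite (range (\<lambda>j. 2 ^ j :: nat))"
    by (intro range_inj_infinite injI) simp
  ultimately show ?thesis
    using finite_subset by blast
qed

text \<open>The sequence is indexed from 1, whereas \<^const>\<open>enumerate\<close> starts at 0; the value at 0 is
  never used.\<close>

definition s :: "nat \<Rightarrow> nat" where
  "s n = enumerate S (n - 1)"

definition circle_prob :: "real measure \<Rightarrow> bool" where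
  "circle_prob \<mu> \<longleftrightarrow> prob_space \<mu> \<and> sets \<mu> = sets circle_borel"

definition S_invariant :: "real measure \<Rightarrow> bool" where
  "S_invariant \<mu> \<longleftrightarrow>
     distr \<mu> circle_borel (sigma_map 2) = \<mu> \<and> distr \<mu> circle_borel (sigma_map 3) = \<mu>"

definition S_ergodic :: "real measure \<Rightarrow> bool" where
  "S_ergodic \<mu> \<longleftrightarrow>
     (\<forall>h :: real \<Rightarrow> complex. h \<in> borel_measurable \<mu>
        \<and> (AE x in \<mu>. h (sigma_map 2 x) = h x) \<and> (AE x in \<mu>. h (sigma_map 3 x) = h x)
        \<longrightarrow> (\<exists>c. AE x in \<mu>. h x = c))"

text \<open>Since \<open>ln 0 = 0\<close> in HOL, this also takes the right value at 0.\<close>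

definition log_plus :: "real \<Rightarrow> real" where
  "log_plus t = max 0 (ln t)"

definition L_log_L :: "real measure \<Rightarrow> (real \<Rightarrow> complex) \<Rightarrow> bool" where
  "L_log_L \<mu> f \<longleftrightarrow>
     f \<in> borel_measurable \<mu> \<and> (\<integral>\<^sup>+ x. ennreal (norm (f x) * log_plus (norm (f x))) \<partial>\<mu>) < \<infinity>"

text \<open>The average of the point masses at \<open>s 1 * x, \<dots>, s N * x\<close> modulo 1, for \<open>N \<ge> 1\<close>: the image
  of the uniform distribution on \<open>{1..N}\<close>.\<close>

definition empirical_measure :: "nat \<Rightarrow> real \<Rightarrow> real measure" where
  "empirical_measure N x =
     distr (uniform_count_measure {1..N}) circle_borel (\<lambda>n. sigma_map (s n) x)"

definition weak_star_tendsto :: "(nat \<Rightarrow> real measure) \<Rightarrow> real measure \<Rightarrow> bool" where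
  "weak_star_tendsto \<nu> \<mu> \<longleftrightarrow>
     (\<forall>g. circle_continuous g \<longrightarrow> (\<lambda>N. \<integral>x. g x \<partial>(\<nu> N)) \<longlonglongrightarrow> (\<integral>x. g x \<partial>\<mu>))"

definition equidistributed_mod1 :: "(nat \<Rightarrow> real) \<Rightarrow> bool" where
  "equidistributed_mod1 u \<longleftrightarrow>
     (\<forall>a b. 0 \<le> a \<and> a < b \<and> b \<le> 1 \<longrightarrow>
        (\<lambda>N. real (card {n \<in> {1..N}. frac (u n) \<in> {a..<b}}) / real N) \<longlonglongrightarrow> b - a)"

definition W :: "real set" where
  "W = {x \<in> {0..<1}. \<not> equidistributed_mod1 (\<lambda>n. real (s n) * x)}"

definition furstenberg_conjecture :: bool where
  "furstenberg_conjecture \<longleftrightarrow>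
     (\<forall>\<mu>. circle_prob \<mu> \<and> S_invariant \<mu> \<and> (\<forall>x \<in> {0..<1}. emeasure \<mu> {x} = 0)
        \<longrightarrow> \<mu> = circle_lebesgue)"

end

theory Submission
  imports Defs
begin

text \<open>Writing the sum over \<open>s\<^sub>1, \<dots>, s\<^sub>N\<close> as a sum over pairs \<open>(j, k)\<close>, the averages run over triangles in
  \<open>\<nat>\<^sup>2\<close> that fill a fixed proportion of the enclosing squares. A Vitali covering of squares,
  transferred along orbits, gives a weak type (1,1) maximal inequality, which already covers all
  integrable functions. For a bounded function \<open>f\<close> of mean zero, the averages of \<open>f\<close> and of any convex
  combination of its images under the semigroup agree in the limit, and by the mean ergodic theorem
  some such combination has arbitrarily small \<open>L\<^sup>1\<close> norm; the maximal inequality turns this into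
  convergence almost everywhere.

  The last claim needs no ergodic decomposition. The set \<open>W\<close> is invariant and, by integrating
  frequencies, it is not null for an invariant measure different from Lebesgue measure. Conditioning
  that measure on \<open>W\<close> gives the required measure, which has no atoms if the original one has none.\<close>

section \<open>The semigroup generated by 2 and 3\<close>

text \<open>Unique factorisation by coprimality: each prime power must divide the power of the same
  prime on the other side. It allows sums over \<open>S\<close> to be reindexed by pairs of
  exponents.\<close>

lemma two_three_inj: "inj_on (\<lambda>(i, j). 2 ^ i * 3 ^ j :: nat) A"
proof -
  have le: "a \<le> c \<and> b \<le> d" if "(2::nat) ^ a * 3 ^ b = 2 ^ c * 3 ^ d" for a b c d :: nat
  proof
    have "(2::nat) ^ a dvd 2 ^ c * 3 ^ d" "(3::nat) ^ b dvd 2 ^ c * 3 ^ d"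
      using that by (metis dvd_triv_left, metis dvd_triv_right)
    moreover have "coprime ((2::nat) ^ a) (3 ^ d)" "coprime ((3::nat) ^ b) (2 ^ c)"
      by (simp_all add: coprime_commute)
    ultimately have "(2::nat) ^ a dvd 2 ^ c" "(3::nat) ^ b dvd 3 ^ d"
      by (simp_all add: coprime_dvd_mult_left_iff coprime_dvd_mult_right_iff)
    then show "a \<le> c" "b \<le> d"
      by (auto dest: power_dvd_imp_le)
  qed
  show ?thesis
  proof (rule inj_onI, clarify)
    fix a b c d :: nat assume eq: "(2::nat) ^ a * 3 ^ b = 2 ^ c * 3 ^ d"
    show "a = c \<and> b = d"
      using le[OF eq] le[OF eq[symmetric]] by simp
  qed
qed

lemma in_S: "2 ^ i * 3 ^ j \<in> S"
  unfolding S_def by blast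

lemma s_in_S: "s n \<in> S"
  unfolding s_def by (rule enumerate_in_set[OF infinite_S])

lemma S_pos: "m \<in> S \<Longrightarrow> 0 < m"
  unfolding S_def by auto

lemma inj_on_s: "inj_on s {1..N}"
proof (rule inj_onI)
  fix m n assume "m \<in> {1..N}" "n \<in> {1..N}" "s m = s n"
  then show "m = n"
    using enumerate_mono_iff[OF infinite_S, of "m - 1" "n - 1"]
      enumerate_mono_iff[OF infinite_S, of "n - 1" "m - 1"]
    unfolding s_def by force
qed

text \<open>Turns membership among the first \<open>N\<close> terms into a comparison of size. The
  case \<open>N = 0\<close> must be excluded: truncated subtraction makes \<open>s 0\<close> equal
  to \<open>s 1\<close>, so the right side would still contain 1.\<close>

lemma s_image:
  assumes "1 \<le> N"
  shows "s ` {1..N} = {m \<in> S. m \<le> s N}"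
proof (intro equalityI subsetI)
  fix m assume "m \<in> s ` {1..N}"
  then show "m \<in> {m \<in> S. m \<le> s N}"
    using s_in_S enumerate_mono_le_iff[OF infinite_S] by (auto simp: s_def)
next
  fix m assume "m \<in> {m \<in> S. m \<le> s N}"
  moreover then obtain k where "enumerate S k = m"
    using enumerate_Ex[OF infinite_S, of m] by auto
  ultimately have "k \<le> N - 1" "m = s (Suc k)"
    using enumerate_mono_le_iff[OF infinite_S, of k "N - 1"] by (auto simp: s_def)
  then show "m \<in> s ` {1..N}"
    using assms by auto
qed

text \<open>The first \<open>N\<close> elements of \<open>S\<close> form a triangle of exponents
  inside a square of side \<open>L\<close>. A smaller square of comparable side lies inside the
  triangle, which bounds \<open>N\<close> from below by a fixed fraction of the area of the large
  one.\<close>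

lemma dyadic_scale:
  assumes "1 \<le> N"
  obtains L where "1 \<le> L" "L\<^sup>2 \<le> 16 * N" "\<And>m. m \<in> s ` {1..N} \<Longrightarrow> m < 2 ^ L"
proof -
  obtain l where l: "2 ^ l \<le> s N" "s N < 2 ^ (l + 1)"
    using ex_power_ivl1[of 2 "s N"] S_pos[OF s_in_S, of N] by auto
  \<comment> \<open>Exponents below \<open>k\<close> satisfy
    \<open>i + 2 * j \<le> 3 * (l div 4) \<le> l\<close>, while the added 1 makes up for rounding,
    so that \<open>l + 1 \<le> 4 * k\<close>.\<close>
  define k where "k = l div 4 + 1"
  have "2 ^ i * 3 ^ j \<in> s ` {1..N}" if "i < k" "j < k" for i j
  proof -
    have ij: "i + 2 * j \<le> l" using that by (auto simp: k_def)
    have "(2::nat) ^ i * 3 ^ j \<le> 2 ^ i * 4 ^ j"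
      by (intro mult_left_mono power_mono) auto
    also have "\<dots> = 2 ^ (i + 2 * j)"
      by (simp add: power_add power_mult)
    also have "\<dots> \<le> 2 ^ l"
      using ij by (intro power_increasing) auto
    finally show ?thesis
      using l s_image[OF assms] in_S by auto
  qed
  then have "(\<lambda>(i, j). 2 ^ i * 3 ^ j) ` ({..<k} \<times> {..<k}) \<subseteq> s ` {1..N}"
    by auto
  then have "card ((\<lambda>(i, j). 2 ^ i * 3 ^ j :: nat) ` ({..<k} \<times> {..<k})) \<le> card (s ` {1..N})"
    by (intro card_mono) auto
  then have "k * k \<le> N"
    using card_image[OF inj_on_s, of N] by (simp add: card_image[OF two_three_inj] card_cartesian_product)
  moreover have "(l + 1)\<^sup>2 \<le> (4 * k)\<^sup>2"
    by (intro power_mono) (auto simp: k_def)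
  ultimately have "(l + 1)\<^sup>2 \<le> 16 * N"
    by (simp add: power2_eq_square algebra_simps)
  moreover have "m < 2 ^ (l + 1)" if "m \<in> s ` {1..N}" for m
    using that l s_image[OF assms] by auto
  ultimately show thesis
    by (intro that[of "l + 1"]) auto
qed

lemma two_three_less_power:
  assumes "2 ^ i * 3 ^ j < (2::nat) ^ L"
  shows "i < L" "j < L"
proof -
  have "(2::nat) ^ i \<le> 2 ^ i * 3 ^ j" "(2::nat) ^ j \<le> 3 ^ j" "(3::nat) ^ j \<le> 2 ^ i * 3 ^ j"
    by (auto intro: power_mono)
  then have "(2::nat) ^ i < 2 ^ L" "(2::nat) ^ j < 2 ^ L"
    using assms by linarith+
  then show "i < L" "j < L"
    by simp_all
qed

text \<open>By nonnegativity the sum may be enlarged from the triangle of exponents to a square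
  containing it. This is how averages in the order of \<open>S\<close> are dominated by sums over
  squares.\<close>

lemma s_sum_le_square:
  fixes F :: "nat \<Rightarrow> real"
  assumes "\<And>m. 0 \<le> F m" "\<And>m. m \<in> s ` {1..N} \<Longrightarrow> m < 2 ^ L"
  shows "(\<Sum>n=1..N. F (s n)) \<le> (\<Sum>(i, j)\<in>{..<L} \<times> {..<L}. F (2 ^ i * 3 ^ j))"
proof -
  let ?g = "\<lambda>(i, j). 2 ^ i * 3 ^ j :: nat"
  have "s ` {1..N} \<subseteq> ?g ` ({..<L} \<times> {..<L})"
  proof
    fix m assume m: "m \<in> s ` {1..N}"
    then obtain i j where "m = 2 ^ i * 3 ^ j"
      using s_in_S unfolding S_def by blast
    then show "m \<in> ?g ` ({..<L} \<times> {..<L})"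
      using assms(2)[OF m] two_three_less_power[of i j L] by force
  qed
  then have "sum F (s ` {1..N}) \<le> sum F (?g ` ({..<L} \<times> {..<L}))"
    using assms(1) by (intro sum_mono2) auto
  also have "\<dots> \<le> sum (F \<circ> ?g) ({..<L} \<times> {..<L})"
    using assms(1) by (intro sum_image_le) auto
  finally show ?thesis
    using sum.reindex[OF inj_on_s, of F N] by (simp add: case_prod_beta o_def)
qed

text \<open>If \<open>q\<close> divides an element \<open>m\<close> of the initial segment, then
  \<open>m / q\<close> is a smaller element of \<open>S\<close> and so belongs to the segment as
  well. The elements left over are therefore powers of the other prime, with exponent below
  \<open>L\<close>.\<close>

lemma S_minus_multiples:
  assumes "q \<in> {2, 3}" "\<And>m. m \<in> s ` {1..N} \<Longrightarrow> m < 2 ^ L" "1 \<le> N"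
  shows "card (s ` {1..N} - (*) q ` s ` {1..N}) \<le> L"
proof -
  \<comment> \<open>For \<open>q\<close> equal to 2 or 3, this is the other generator.\<close>
  let ?r = "5 - q"
  have "s ` {1..N} - (*) q ` s ` {1..N} \<subseteq> (\<lambda>i. ?r ^ i) ` {..<L}"
  proof
    fix m assume m: "m \<in> s ` {1..N} - (*) q ` s ` {1..N}"
    then obtain i j where ij: "m = 2 ^ i * 3 ^ j"
      using s_in_S unfolding S_def by blast
    have q: "m \<noteq> q * m'" if "m' \<in> S" for m'
      using m that assms(1) unfolding s_image[OF assms(3)] by auto
    have "(if q = 2 then i else j) = 0"
    proof (rule ccontr)
      assume "(if q = 2 then i else j) \<noteq> 0"
      then have "m = q * (if q = 2 then 2 ^ (i - 1) * 3 ^ j else 2 ^ i * 3 ^ (j - 1))"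
        using assms(1) ij by (cases "q = 2"; cases i; cases j) simp_all
      moreover have "(if q = 2 then 2 ^ (i - 1) * 3 ^ j else 2 ^ i * 3 ^ (j - 1)) \<in> S"
        by (simp add: in_S)
      ultimately show False using q by blast
    qed
    have "m = ?r ^ (if q = 2 then j else i)"
      using assms(1) \<open>(if q = 2 then i else j) = 0\<close> ij by (cases "q = 2") simp_all
    moreover have "i < L" "j < L"
      using two_three_less_power[of i j L] assms(2)[of m] m ij by auto
    ultimately show "m \<in> (\<lambda>i. ?r ^ i) ` {..<L}"
      by (metis image_eqI lessThan_iff)
  qed
  then have "card (s ` {1..N} - (*) q ` s ` {1..N}) \<le> card ((\<lambda>i. ?r ^ i) ` {..<L})"
    by (intro card_mono) auto
  also have "\<dots> \<le> L"
    using card_image_le[of "{..<L}" "\<lambda>i. ?r ^ i"] by simp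
  finally show ?thesis .
qed

text \<open>Multiplying \<open>{s\<^sub>1, \<dots>, s\<^sub>N}\<close> by \<open>q\<close> only changes the \<open>O(\<surd>N)\<close> boundary elements that are powers
  of a single prime.\<close>

lemma s_sum_shift_bound:
  fixes F :: "nat \<Rightarrow> real"
  assumes F: "\<And>m. \<bar>F m\<bar> \<le> K" and q: "q \<in> {2, 3}" and N: "1 \<le> N"
  shows "\<bar>(\<Sum>n=1..N. F (s n)) - (\<Sum>n=1..N. F (q * s n))\<bar> \<le> 8 * K * sqrt N"
proof -
  obtain L where L: "1 \<le> L" "L\<^sup>2 \<le> 16 * N" "\<And>m. m \<in> s ` {1..N} \<Longrightarrow> m < 2 ^ L"
    using dyadic_scale[OF N] by blast
  let ?A = "s ` {1..N}" and ?B = "(*) q ` s ` {1..N}"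
  have K: "0 \<le> K" using F[of 0] by linarith
  have inj: "inj_on ((*) q) ?A"
    using q by (auto simp: inj_on_def)
  have "card ?B = card ?A"
    using inj by (rule card_image)
  \<comment> \<open>Sets of equal size have differences of equal size, so only the elements of
    \<open>?A\<close> outside \<open>?B\<close> need to be counted.\<close>
  then have c: "card (?B - ?A) = card (?A - ?B)"
    by (metis card_Diff_subset_Int finite_imageI finite_atLeastAtMost Int_commute finite_Int)
  have "(\<Sum>n=1..N. F (s n)) = sum F ?A"
    using sum.reindex[OF inj_on_s, of F N] by (simp add: o_def)
  moreover have "(\<Sum>n=1..N. F (q * s n)) = sum F ?B"
    using sum.reindex[OF inj_on_s, of "\<lambda>m. F (q * m)" N] sum.reindex[OF inj, of F]
    by (simp add: o_def)
  moreover have "sum F ?A = sum F (?A - ?B) + sum F (?A \<inter> ?B)"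
    by (subst sum.union_disjoint[symmetric]) (auto intro!: sum.cong)
  moreover have "sum F ?B = sum F (?B - ?A) + sum F (?A \<inter> ?B)"
    by (subst sum.union_disjoint[symmetric]) (auto intro!: sum.cong)
  moreover have bound: "\<bar>sum F X\<bar> \<le> L * K" if "card X \<le> L" for X
  proof -
    have "\<bar>sum F X\<bar> \<le> card X * K"
      using order_trans[OF sum_abs sum_bounded_above[of X "\<lambda>m. \<bar>F m\<bar>" K]] F by simp
    also have "\<dots> \<le> L * K"
      using that K by (intro mult_right_mono) auto
    finally show ?thesis .
  qed
  have "card (?A - ?B) \<le> L"
    using S_minus_multiples[OF q L(3) N] .
  then have "\<bar>sum F (?A - ?B)\<bar> \<le> L * K" "\<bar>sum F (?B - ?A)\<bar> \<le> L * K"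
    using bound c by simp_all
  ultimately have "\<bar>(\<Sum>n=1..N. F (s n)) - (\<Sum>n=1..N. F (q * s n))\<bar> \<le> 2 * (L * K)"
    by linarith
  \<comment> \<open>Two boundary sets of at most \<open>L\<close> elements, with \<open>L\<close> at
    most \<open>4 * sqrt N\<close>, give the constant 8.\<close>
  also have "L * K \<le> 4 * sqrt N * K"
  proof (rule mult_right_mono[OF _ K])
    have "(real L)\<^sup>2 \<le> 16 * real N"
      using of_nat_mono[OF L(2), where 'a=real] by simp
    then have "real L \<le> sqrt (16 * real N)"
      by (rule real_le_rsqrt)
    then show "L \<le> 4 * sqrt N"
      by (simp add: real_sqrt_mult)
  qed
  finally show ?thesis by (simp add: mult_ac)
qed

text \<open>A boundary of order \<open>sqrt N\<close> is negligible against \<open>N\<close>: the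
  initial segments of \<open>S\<close> form a Folner sequence for multiplication by 2 and 3. No
  measure is involved, so the consequences hold at every point of the circle.\<close>

lemma s_average_shift_tendsto_0:
  fixes F :: "nat \<Rightarrow> real"
  assumes "\<And>m. \<bar>F m\<bar> \<le> K" "q \<in> {2, 3}"
  shows "(\<lambda>N. (\<Sum>n=1..N. F (s n)) / N - (\<Sum>n=1..N. F (q * s n)) / N) \<longlonglongrightarrow> 0"
proof (rule Lim_null_comparison)
  have "norm ((\<Sum>n=1..N. F (s n)) / N - (\<Sum>n=1..N. F (q * s n)) / N) \<le> 8 * K * sqrt N / N"
    if "1 \<le> N" for N
    using divide_right_mono[OF s_sum_shift_bound[OF assms that], of N]
    by (simp add: diff_divide_distrib[symmetric])
  then show "\<forall>\<^sub>F N in sequentially. norm ((\<Sum>n=1..N. F (s n)) / N - (\<Sum>n=1..N. F (q * s n)) / N)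
      \<le> 8 * K * sqrt N / N"
    by (rule eventually_sequentiallyI)
  have "(\<lambda>N. 8 * K * (1 / sqrt (real N))) \<longlonglongrightarrow> 8 * K * 0"
    by (intro tendsto_mult tendsto_const tendsto_divide_0[OF tendsto_const]
        filterlim_at_top_imp_at_infinity filterlim_compose[OF sqrt_at_top] filterlim_real_sequentially)
  moreover have "8 * K * (1 / sqrt (real N)) = 8 * K * sqrt N / N" for N
    using sqrt_divide_self_eq[of "real N"]
    by (simp only: times_divide_eq_right[symmetric] inverse_eq_divide of_nat_0_le_iff simp_thms)
  ultimately show "(\<lambda>N. 8 * K * sqrt N / N) \<longlonglongrightarrow> 0"
    by simp
qed

section \<open>A maximal inequality by transference\<close>

definition square :: "nat \<times> nat \<Rightarrow> nat \<Rightarrow> (nat \<times> nat) set" where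
  "square p n = {fst p..<fst p + n} \<times> {snd p..<snd p + n}"

lemma finite_square [simp]: "finite (square p n)"
  by (simp add: square_def)

text \<open>A square of side at most \<open>n\<close> that meets a square of side \<open>n\<close>
  has its corner within \<open>n\<close> of the other corner in each coordinate, hence in a box of
  side \<open>2 * n\<close>. Truncated subtraction can only shrink that box.\<close>

lemma card_corners_le:
  assumes "\<And>p. p \<in> A \<Longrightarrow> r p \<le> n" "\<And>p. p \<in> A \<Longrightarrow> square p (r p) \<inter> square p' n \<noteq> {}"
  shows "card A \<le> 4 * n\<^sup>2"
proof -
  have "p \<in> {fst p' - n..<fst p' + n} \<times> {snd p' - n..<snd p' + n}" if p: "p \<in> A" for p
    using assms(1)[OF p] assms(2)[OF p] by (cases p) (force simp: square_def)
  then have "card A \<le> card ({fst p' - n..<fst p' + n} \<times> {snd p' - n..<snd p' + n})"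
    by (intro card_mono) auto
  also have "\<dots> \<le> (2 * n) * (2 * n)"
    unfolding card_cartesian_product by (intro mult_mono) auto
  finally show ?thesis
    by (simp add: power2_eq_square)
qed

text \<open>Greedy selection: a square of maximal side absorbs every square that meets it, at the cost
  of at most four times its own area, and what remains avoids it.\<close>

lemma covering_squares:
  fixes F :: "nat \<times> nat \<Rightarrow> real"
    and c :: real
  assumes "finite A" "finite B" "\<And>p. 0 \<le> F p" "0 \<le> c"
    and "\<And>p. p \<in> A \<Longrightarrow> 1 \<le> r p"
    and "\<And>p. p \<in> A \<Longrightarrow> square p (r p) \<subseteq> B"
    and "\<And>p. p \<in> A \<Longrightarrow> c * (r p)\<^sup>2 \<le> sum F (square p (r p))"
  shows "c * card A \<le> 4 * sum F B"
  using assms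
proof (induction "card A" arbitrary: A B rule: less_induct)
  case less
  show ?case
  proof (cases "A = {}")
    case True
    then show ?thesis using less.prems(3) by (simp add: sum_nonneg)
  next
    case False
    then have "Max (r ` A) \<in> r ` A"
      using less.prems(1) by (intro Max_in) auto
    then obtain p' where "p' \<in> A" "Max (r ` A) = r p'" by blast
    then have p': "p' \<in> A" "\<And>p. p \<in> A \<Longrightarrow> r p \<le> r p'"
      using less.prems(1) by (metis Max_ge finite_imageI imageI)+
    let ?Q = "square p' (r p')"
    define A1 where "A1 = {p \<in> A. square p (r p) \<inter> ?Q \<noteq> {}}"
    define A2 where "A2 = A - A1"
    have "p' \<in> A1"
      using less.prems(5)[OF p'(1)] p'(1) by (cases p') (force simp: A1_def square_def)
    then have "card A2 < card A"
      using less.prems(1) by (auto simp: A2_def A1_def intro!: psubset_card_mono)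
    \<comment> \<open>The remaining squares lie in \<open>B - ?Q\<close>, so the induction
      hypothesis and the bound for \<open>A1\<close> draw on disjoint parts of the sum over
      \<open>B\<close>.\<close>
    moreover have "square p (r p) \<subseteq> B - ?Q" if "p \<in> A2" for p
      using that less.prems(6)[of p] by (auto simp: A2_def A1_def)
    ultimately have IH: "c * card A2 \<le> 4 * sum F (B - ?Q)"
      using less.prems by (intro less.hyps) (auto simp: A2_def)
    have "card A1 \<le> 4 * (r p')\<^sup>2"
      by (rule card_corners_le[of A1 r _ p']) (use p'(2) in \<open>simp_all add: A1_def\<close>)
    then have "real (card A1) \<le> real (4 * (r p')\<^sup>2)"
      by (rule of_nat_mono)
    then have "c * card A1 \<le> c * real (4 * (r p')\<^sup>2)"
      using less.prems(4) by (rule mult_left_mono)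
    then have "c * card A1 \<le> 4 * (c * (r p')\<^sup>2)"
      by (simp add: mult.left_commute)
    also have "\<dots> \<le> 4 * sum F ?Q"
      using less.prems(7)[OF p'(1)] by simp
    finally have "c * card A1 \<le> 4 * sum F ?Q" .
    moreover have "sum F B = sum F (B - ?Q) + sum F ?Q"
      using less.prems(2) less.prems(6)[OF p'(1)] by (intro sum.subset_diff) auto
    moreover have "card A = card A1 + card A2"
      unfolding A2_def using less.prems(1)
      by (subst card_Un_disjoint[symmetric]) (auto simp: A1_def intro!: arg_cong[where f=card])
    ultimately show ?thesis
      using IH by (simp add: algebra_simps)
  qed
qed

section \<open>Multiplication maps on the circle and their invariant measures\<close>

lemma sigma_map_bounds [simp]: "0 \<le> sigma_map q x" "sigma_map q x < 1"
  by (simp_all add: sigma_map_def frac_lt_1)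

text \<open>Replacing \<open>n * x\<close> by its fractional part changes the product with
  \<open>m\<close> by an integer, which \<open>frac\<close> ignores.\<close>

lemma sigma_map_sigma_map: "sigma_map m (sigma_map n x) = sigma_map (m * n) x"
proof -
  have "real m * frac (real n * x) = real (m * n) * x - of_int (int m * \<lfloor>real n * x\<rfloor>)"
    by (simp add: frac_def algebra_simps)
  then show ?thesis
    by (simp only: sigma_map_def frac_def floor_diff_of_int of_int_diff)
qed

lemma sigma_map_1: "x \<in> {0..<1} \<Longrightarrow> sigma_map 1 x = x"
  by (simp add: sigma_map_def frac_eq)

lemma space_circle_borel [simp]: "space circle_borel = {0..<1}"
  by (simp add: circle_borel_def space_restrict_space)

lemma measurable_sigma_map [measurable]: "sigma_map q \<in> circle_borel \<rightarrow>\<^sub>M circle_borel"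
proof -
  have "sigma_map q \<in> borel_measurable circle_borel"
    unfolding circle_borel_def sigma_map_def frac_def
    by (intro measurable_restrict_space1) measurable
  then show ?thesis
    using measurable_restrict_space2_iff[of "sigma_map q" circle_borel borel "{0..<1}"]
    by (simp add: circle_borel_def[symmetric] Pi_iff)
qed

text \<open>Ergodicity is assumed separately where it enters, so that the last claim can work with
  an arbitrary invariant measure.\<close>

locale S_system = prob_space M for M :: "real measure" +
  assumes sets_M: "sets M = sets circle_borel"
    and invariant: "S_invariant M"
begin

lemma space_M [simp]: "space M = {0..<1}"
  using sets_eq_imp_space_eq[OF sets_M] by simp

lemma prob_circle [simp]: "measure M {0..<1} = 1"
  using prob_space by simp

lemma sigma_measurable [measurable]: "sigma_map q \<in> M \<rightarrow>\<^sub>M M"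
  by (simp add: measurable_cong_sets[OF sets_M sets_M])

text \<open>Invariance under the two generators passes to products by composing image measures. The
  induction starts from \<open>sigma_map 1\<close>, which is the identity on
  \<open>{0..<1}\<close>.\<close>

lemma distr_sigma:
  assumes "m \<in> S"
  shows "distr M M (sigma_map m) = M"
proof -
  have mult: "distr M M (sigma_map (q * m)) = M"
    if "distr M M (sigma_map m) = M" "distr M circle_borel (sigma_map q) = M" for q m
  proof -
    have "distr M M (sigma_map (q * m)) = distr (distr M M (sigma_map m)) M (sigma_map q)"
      by (subst distr_distr) (auto simp: sigma_map_sigma_map intro!: distr_cong)
    also have "\<dots> = distr M circle_borel (sigma_map q)"
      using that(1) sets_M by (auto intro: distr_cong)
    finally show ?thesis
      using that(2) by simp
  qed
  have one: "distr M M (sigma_map 1) = M"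
  proof -
    have "distr M M (sigma_map 1) = distr M M (\<lambda>x. x)"
      by (intro distr_cong) (auto simp: sigma_map_1[unfolded One_nat_def])
    then show ?thesis by simp
  qed
  have three: "distr M M (sigma_map (3 ^ k)) = M" for k
    using invariant one by (induction k) (auto simp: S_invariant_def mult)
  have "distr M M (sigma_map (2 ^ j * 3 ^ k)) = M" for j k
    using invariant three by (induction j) (auto simp: S_invariant_def mult mult.assoc)
  then show ?thesis
    using assms by (auto simp: S_def)
qed

lemma
  fixes f :: "real \<Rightarrow> real"
  assumes "m \<in> S"
  shows integrable_sigma: "integrable M f \<Longrightarrow> integrable M (\<lambda>x. f (sigma_map m x))"
    and integral_sigma:
      "f \<in> borel_measurable M \<Longrightarrow> (\<integral>x. f (sigma_map m x) \<partial>M) = (\<integral>x. f x \<partial>M)"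
proof -
  show "integrable M (\<lambda>x. f (sigma_map m x))" if "integrable M f"
    by (rule integrable_distr[where M' = M]) (use that distr_sigma[OF assms] in simp_all)
  show "(\<integral>x. f (sigma_map m x) \<partial>M) = (\<integral>x. f x \<partial>M)" if "f \<in> borel_measurable M"
    using integral_distr[OF sigma_measurable that, of m] distr_sigma[OF assms] by simp
qed

lemma AE_sigma:
  assumes "m \<in> S" "AE x in M. P x"
  shows "AE x in M. P (sigma_map m x)"
  by (rule AE_distrD[where M' = M]) (simp_all only: distr_sigma[OF assms(1)] assms(2) sigma_measurable)

section \<open>Sums over squares of exponents and their maximal function\<close>

definition square_sum :: "(real \<Rightarrow> real) \<Rightarrow> nat \<Rightarrow> real \<Rightarrow> real" where
  "square_sum f n x = (\<Sum>(i, j)\<in>{..<n} \<times> {..<n}. f (sigma_map (2 ^ i * 3 ^ j) x))"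

lemma square_sum_measurable [measurable]:
  "f \<in> borel_measurable M \<Longrightarrow> square_sum f n \<in> borel_measurable M"
  unfolding square_sum_def case_prod_beta
  by (intro borel_measurable_sum measurable_compose[OF sigma_measurable])

text \<open>Moving the base point along its orbit translates the square of exponents. This turns
  large sums at orbit points into large sums over translated squares, to which the covering lemma
  applies.\<close>

lemma square_sum_sigma:
  "square_sum f n (sigma_map (2 ^ fst p * 3 ^ snd p) x) =
    (\<Sum>(i, j)\<in>square p n. f (sigma_map (2 ^ i * 3 ^ j) x))"
proof -
  have "square p n = (\<lambda>q. (fst p + fst q, snd p + snd q)) ` ({..<n} \<times> {..<n})"
  proof (intro equalityI subsetI)
    fix q assume "q \<in> square p n"
    then show "q \<in> (\<lambda>q. (fst p + fst q, snd p + snd q)) ` ({..<n} \<times> {..<n})"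
      by (intro image_eqI[of _ _ "(fst q - fst p, snd q - snd p)"]) (auto simp: square_def)
  qed (auto simp: square_def)
  moreover have inj: "inj_on (\<lambda>q. (fst p + fst q, snd p + snd q)) ({..<n} \<times> {..<n})"
    by (auto simp: inj_on_def)
  ultimately show ?thesis
    by (simp add: square_sum_def sum.reindex[OF inj] case_prod_unfold sigma_map_sigma_map power_add
        mult_ac del: sum.cartesian_product)
qed

text \<open>Calderon's transference: the covering bound is applied to the orbit of each point inside a
  window of side \<open>2 R\<close> and then integrated.\<close>

lemma maximal_inequality_finite:
  fixes f :: "real \<Rightarrow> real"
  assumes f: "integrable M f" "\<And>x. 0 \<le> f x" and c: "0 \<le> c" and R: "1 \<le> R"
  defines "E \<equiv> {x \<in> space M. \<exists>n\<in>{1..R}. c * n\<^sup>2 \<le> square_sum f n x}"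
  shows "c * measure M E \<le> 16 * (\<integral>x. f x \<partial>M)"
proof -
  have [measurable]: "f \<in> borel_measurable M"
    using f(1) by auto
  have E [measurable]: "E \<in> sets M"
    unfolding E_def by measurable
  let ?t = "\<lambda>p. 2 ^ fst p * 3 ^ snd p :: nat"
  have pointwise: "c * (\<Sum>p\<in>square (0, 0) R. indicator E (sigma_map (?t p) x))
      \<le> 4 * (\<Sum>p\<in>square (0, 0) (2 * R). f (sigma_map (?t p) x))" for x
  proof -
    \<comment> \<open>These are the exponents at which the orbit of \<open>x\<close> visits
      \<open>E\<close>; each visit supplies a side \<open>r p\<close> whose translated square
      carries a large sum.\<close>
    define A where "A = {p \<in> square (0, 0) R. sigma_map (?t p) x \<in> E}"
    have "\<exists>n. n \<in> {1..R} \<and> c * n\<^sup>2 \<le> square_sum f n (sigma_map (?t p) x)" if "p \<in> A" for p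
      using that by (auto simp: A_def E_def)
    then obtain r where r: "\<And>p. p \<in> A \<Longrightarrow> r p \<in> {1..R}"
      "\<And>p. p \<in> A \<Longrightarrow> c * (r p)\<^sup>2 \<le> square_sum f (r p) (sigma_map (?t p) x)"
      by metis
    have "c * card A \<le> 4 * (\<Sum>p\<in>square (0, 0) (2 * R). f (sigma_map (?t p) x))"
    proof (rule covering_squares)
      show "square p (r p) \<subseteq> square (0, 0) (2 * R)" if "p \<in> A" for p
        using that r(1)[OF that] by (force simp: A_def square_def)
      show "c * (r p)\<^sup>2 \<le> (\<Sum>p\<in>square p (r p). f (sigma_map (?t p) x))" if "p \<in> A" for p
        using r(2)[OF that] by (simp add: square_sum_sigma case_prod_beta)
    qed (use r(1) f(2) c in \<open>auto simp: A_def\<close>)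
    moreover have "(\<Sum>p\<in>square (0, 0) R. indicator E (sigma_map (?t p) x)) = real (card A)"
      by (simp add: A_def indicator_def sum_of_bool_eq Int_def)
    ultimately show ?thesis by simp
  qed
  have int: "integrable M (\<lambda>x. f (sigma_map (?t p) x))"
    "integrable M (\<lambda>x. indicator E (sigma_map (?t p) x) :: real)" for p
    using f(1) in_S by (auto intro!: integrable_sigma integrable_real_indicator simp: emeasure_eq_measure)
  have "(\<integral>x. c * (\<Sum>p\<in>square (0, 0) R. indicator E (sigma_map (?t p) x)) \<partial>M)
      \<le> (\<integral>x. 4 * (\<Sum>p\<in>square (0, 0) (2 * R). f (sigma_map (?t p) x)) \<partial>M)"
    using int by (intro integral_mono pointwise) auto
  \<comment> \<open>By invariance every term has the same integral, with
    \<open>(2 * R)\<^sup>2\<close> terms here against \<open>R\<^sup>2\<close> on the other side.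
    The ratio 4 times the covering constant 4 gives 16, independently of \<open>R\<close>.\<close>
  also have "(\<integral>x. 4 * (\<Sum>p\<in>square (0, 0) (2 * R). f (sigma_map (?t p) x)) \<partial>M)
      = 4 * ((2 * R)\<^sup>2 * (\<integral>x. f x \<partial>M))"
    using int by (simp add: integral_sigma in_S square_def power2_eq_square)
  also have "(\<integral>x. c * (\<Sum>p\<in>square (0, 0) R. indicator E (sigma_map (?t p) x)) \<partial>M)
      = c * (R\<^sup>2 * measure M (E \<inter> {0..<1}))"
    using int by (simp add: integral_sigma[where f = "indicator E"] in_S square_def power2_eq_square)
  also have "E \<inter> {0..<1} = E"
    using sets.sets_into_space[OF E] by auto
  finally have "R\<^sup>2 * (c * measure M E) \<le> R\<^sup>2 * (16 * (\<integral>x. f x \<partial>M))"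
    by (simp add: mult_ac power2_eq_square)
  then show ?thesis
    using R by simp
qed

text \<open>The finite bound does not depend on \<open>R\<close>, and the sets for finite
  \<open>R\<close> increase to the full one, so continuity from below applies.\<close>

lemma maximal_inequality:
  fixes f :: "real \<Rightarrow> real"
  assumes f: "integrable M f" "\<And>x. 0 \<le> f x" and c: "0 \<le> c"
  shows "c * measure M {x \<in> space M. \<exists>n\<ge>1. c * n\<^sup>2 \<le> square_sum f n x} \<le> 16 * (\<integral>x. f x \<partial>M)"
proof -
  define E where "E R = {x \<in> space M. \<exists>n\<in>{1..R}. c * n\<^sup>2 \<le> square_sum f n x}" for R
  have [measurable]: "f \<in> borel_measurable M"
    using f(1) by auto
  have "(\<lambda>R. measure M (E R)) \<longlonglongrightarrow> measure M (\<Union>R. E R)"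
  proof (rule finite_Lim_measure_incseq)
    have "E R \<in> sets M" for R
      unfolding E_def by measurable
    then show "range E \<subseteq> sets M" by blast
    show "incseq E"
      by (fastforce simp: incseq_def E_def)
  qed
  then have "(\<lambda>R. c * measure M (E R)) \<longlonglongrightarrow> c * measure M (\<Union>R. E R)"
    by (rule tendsto_mult_left)
  moreover have "c * measure M (E R) \<le> 16 * (\<integral>x. f x \<partial>M)" if "1 \<le> R" for R
    unfolding E_def by (rule maximal_inequality_finite[OF f c that])
  ultimately have "c * measure M (\<Union>R. E R) \<le> 16 * (\<integral>x. f x \<partial>M)"
    by (intro LIMSEQ_le_const2) auto
  moreover have "(\<Union>R. E R) = {x \<in> space M. \<exists>n\<ge>1. c * n\<^sup>2 \<le> square_sum f n x}"
    by (force simp: E_def)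
  ultimately show ?thesis by simp
qed

end

section \<open>The pointwise ergodic theorem\<close>

text \<open>Generic in the field because the argument runs over the reals and the result concerns
  complex functions. The value for \<open>N = 0\<close> is 0.\<close>

definition orbit_average :: "(real \<Rightarrow> 'a::real_normed_field) \<Rightarrow> nat \<Rightarrow> real \<Rightarrow> 'a" where
  "orbit_average f N x = (\<Sum>n = 1..N. f (sigma_map (s n) x)) / of_nat N"

lemma orbit_average_add:
  "orbit_average (\<lambda>x. f x + g x) N x = orbit_average f N x + orbit_average g N x"
  by (simp add: orbit_average_def sum.distrib add_divide_distrib)

lemma orbit_average_diff:
  "orbit_average (\<lambda>x. f x - g x) N x = orbit_average f N x - orbit_average g N x"
  by (simp add: orbit_average_def sum_subtractf diff_divide_distrib)

lemma orbit_average_cmult: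
  "orbit_average (\<lambda>x. a * f x) N x = a * orbit_average f N x"
  by (simp add: orbit_average_def sum_distrib_left)

lemma orbit_average_const: "1 \<le> N \<Longrightarrow> orbit_average (\<lambda>x. c) N x = c"
  by (simp add: orbit_average_def)

lemma orbit_average_shift_tendsto_0:
  fixes f :: "real \<Rightarrow> real"
  assumes "\<And>x. \<bar>f x\<bar> \<le> K" "q \<in> {2, 3}"
  shows "(\<lambda>N. orbit_average f N x - orbit_average (\<lambda>x. f (sigma_map q x)) N x) \<longlonglongrightarrow> 0"
  using s_average_shift_tendsto_0[of "\<lambda>m. f (sigma_map m x)" K q] assms
  by (simp add: orbit_average_def sigma_map_sigma_map)

text \<open>A convex hull of the images of \<open>f\<close> under the semigroup, built from
  midpoints only: these are what the parallelogram identity uses. Its members are actual functions,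
  not classes modulo null sets, so bounds hold at every point.\<close>

inductive_set orbit_hull :: "(real \<Rightarrow> real) \<Rightarrow> (real \<Rightarrow> real) set" for f where
  base: "f \<in> orbit_hull f"
| shift: "g \<in> orbit_hull f \<Longrightarrow> q \<in> {2, 3} \<Longrightarrow> (\<lambda>x. g (sigma_map q x)) \<in> orbit_hull f"
| midpoint: "g \<in> orbit_hull f \<Longrightarrow> h \<in> orbit_hull f \<Longrightarrow> (\<lambda>x. (g x + h x) / 2) \<in> orbit_hull f"

lemma in_S_2_3: "q \<in> {2, 3} \<Longrightarrow> q \<in> S"
  using in_S[of 1 0] in_S[of 0 1] by auto

text \<open>By monotone convergence the series of absolute values has finite integral, hence is
  finite almost everywhere. Geometric \<open>L\<^sup>1\<close> bounds thus give pointwise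
  convergence directly.\<close>

lemma (in prob_space) AE_summable_if_summable_integral:
  fixes u :: "nat \<Rightarrow> 'a \<Rightarrow> real"
  assumes u: "\<And>n. integrable M (u n)" and sum: "summable (\<lambda>n. \<integral>x. \<bar>u n x\<bar> \<partial>M)"
  shows "AE x in M. summable (\<lambda>n. u n x)"
proof -
  have [measurable]: "u n \<in> borel_measurable M" for n
    using u by auto
  have "(\<integral>\<^sup>+ x. (\<Sum>n. ennreal \<bar>u n x\<bar>) \<partial>M) = (\<Sum>n. \<integral>\<^sup>+ x. ennreal \<bar>u n x\<bar> \<partial>M)"
    by (rule nn_integral_suminf) measurable
  also have "\<dots> = (\<Sum>n. ennreal (\<integral>x. \<bar>u n x\<bar> \<partial>M))"
    using u by (intro arg_cong[where f = suminf] ext nn_integral_eq_integral) auto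
  also have "\<dots> = ennreal (\<Sum>n. \<integral>x. \<bar>u n x\<bar> \<partial>M)"
    using sum by (intro suminf_ennreal2) auto
  finally have "(\<integral>\<^sup>+ x. (\<Sum>n. ennreal \<bar>u n x\<bar>) \<partial>M) \<noteq> \<infinity>"
    by simp
  then have "AE x in M. (\<Sum>n. ennreal \<bar>u n x\<bar>) \<noteq> \<infinity>"
    by (intro nn_integral_PInf_AE) auto
  then show ?thesis
  proof eventually_elim
    case (elim x)
    then have "summable (\<lambda>n. \<bar>u n x\<bar>)"
      by (intro summable_suminf_not_top) auto
    then show ?case
      by (rule summable_rabs_cancel)
  qed
qed

text \<open>This is nonnegativity of the variance of the absolute value of \<open>u\<close>.\<close>

lemma (in prob_space) L1_le_L2:
  fixes u :: "'a \<Rightarrow> real"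
  assumes "integrable M u" "integrable M (\<lambda>x. (u x)\<^sup>2)"
  shows "(\<integral>x. \<bar>u x\<bar> \<partial>M)\<^sup>2 \<le> (\<integral>x. (u x)\<^sup>2 \<partial>M)"
  using variance_positive[of "\<lambda>x. \<bar>u x\<bar>"] variance_eq[of "\<lambda>x. \<bar>u x\<bar>"] assms by simp

section \<open>The mean ergodic theorem in the orbit hull\<close>

context S_system
begin

lemma bounded_integrable:
  fixes g :: "real \<Rightarrow> real"
  assumes "g \<in> borel_measurable M" "\<And>x. \<bar>g x\<bar> \<le> K"
  shows "integrable M g"
  using assms by (intro integrable_const_bound[where B = K]) auto

text \<open>Each property survives the three rules. For a shift, the integral is kept by invariance
  of the measure and the averages by the negligible boundary, which needs the uniform bound
  \<open>K\<close>.\<close>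

lemma orbit_hull_properties:
  assumes f: "f \<in> borel_measurable M" "\<And>x. \<bar>f x\<bar> \<le> K" and g: "g \<in> orbit_hull f"
  shows "g \<in> borel_measurable M" "\<bar>g x\<bar> \<le> K" "(\<integral>x. g x \<partial>M) = (\<integral>x. f x \<partial>M)"
    and "(\<lambda>N. orbit_average f N x - orbit_average g N x) \<longlonglongrightarrow> 0"
proof -
  have "g \<in> borel_measurable M \<and> (\<forall>x. \<bar>g x\<bar> \<le> K) \<and> (\<integral>x. g x \<partial>M) = (\<integral>x. f x \<partial>M) \<and>
      (\<forall>x. (\<lambda>N. orbit_average f N x - orbit_average g N x) \<longlonglongrightarrow> 0)"
    using g
  proof induction
    case base
    then show ?case using f by simp
  next
    case (shift g q)
    then have [measurable]: "g \<in> borel_measurable M" by simp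
    have "(\<lambda>N. (orbit_average f N x - orbit_average g N x) +
        (orbit_average g N x - orbit_average (\<lambda>x. g (sigma_map q x)) N x)) \<longlonglongrightarrow> 0 + 0" for x
      using shift by (intro tendsto_add orbit_average_shift_tendsto_0) auto
    then show ?case
      using shift by (simp add: integral_sigma in_S_2_3)
  next
    case (midpoint g h)
    then have [measurable]: "g \<in> borel_measurable M" "h \<in> borel_measurable M" by simp_all
    have "integrable M g" "integrable M h"
      using midpoint by (auto intro: bounded_integrable)
    moreover have "\<bar>(g x + h x) / 2\<bar> \<le> K" for x
    proof -
      have "\<bar>g x\<bar> \<le> K" "\<bar>h x\<bar> \<le> K"
        using midpoint.IH by auto
      then have "\<bar>g x + h x\<bar> \<le> 2 * K" by linarith
      then show ?thesis by simp
    qed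
    moreover have "(\<lambda>N. orbit_average f N x - orbit_average (\<lambda>x. (g x + h x) / 2) N x) \<longlonglongrightarrow> 0" for x
    proof -
      have eq: "orbit_average (\<lambda>x. (g x + h x) / 2) N x
          = (orbit_average g N x + orbit_average h N x) / 2" for N
        using orbit_average_cmult[of "1 / 2" "\<lambda>x. g x + h x" N x]
        by (simp add: orbit_average_add)
      have "(\<lambda>N. (orbit_average f N x - orbit_average g N x) / 2 +
          (orbit_average f N x - orbit_average h N x) / 2) \<longlonglongrightarrow> 0 / 2 + 0 / 2"
        using midpoint.IH by (intro tendsto_intros) auto
      also have "(\<lambda>N. (orbit_average f N x - orbit_average g N x) / 2 +
          (orbit_average f N x - orbit_average h N x) / 2) =
          (\<lambda>N. orbit_average f N x - orbit_average (\<lambda>x. (g x + h x) / 2) N x)"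
        by (auto simp: eq field_simps)
      finally show ?thesis by simp
    qed
    ultimately show ?case
      using midpoint.IH by simp
  qed
  then show "g \<in> borel_measurable M" "\<bar>g x\<bar> \<le> K" "(\<integral>x. g x \<partial>M) = (\<integral>x. f x \<partial>M)"
    "(\<lambda>N. orbit_average f N x - orbit_average g N x) \<longlonglongrightarrow> 0"
    by auto
qed

text \<open>F. Riesz's proof of the mean ergodic theorem: by the parallelogram identity a sequence in the
  orbit hull that minimises the \<open>L\<^sup>2\<close> norm is Cauchy and asymptotically invariant, so its limit is
  invariant, hence constant.\<close>

lemma mean_ergodic:
  assumes erg: "S_ergodic M" and f: "f \<in> borel_measurable M" "\<And>x. \<bar>f x\<bar> \<le> K"
    and mean: "(\<integral>x. f x \<partial>M) = 0" and "0 < \<epsilon>"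
  obtains g where "g \<in> orbit_hull f" "(\<integral>x. \<bar>g x\<bar> \<partial>M) \<le> \<epsilon>"
proof -
  note props = orbit_hull_properties[OF f]
  have [measurable]: "g \<in> borel_measurable M" if "g \<in> orbit_hull f" for g
    using props(1)[OF that] .
  have K: "0 \<le> K" using f(2)[of 0] by linarith
  define D where "D g = (\<integral>x. (g x)\<^sup>2 \<partial>M)" for g :: "real \<Rightarrow> real"
  define d where "d = Inf (D ` orbit_hull f)"
  have bdd: "bdd_below (D ` orbit_hull f)"
    by (rule bdd_belowI[of _ 0]) (auto simp: D_def)
  have d_le: "d \<le> D g" if "g \<in> orbit_hull f" for g
    unfolding d_def using that bdd by (intro cInf_lower) auto
  have bounded_prod: "integrable M (\<lambda>x. g x * h x)"
    if [measurable]: "g \<in> borel_measurable M" "h \<in> borel_measurable M"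
      and "\<And>x. \<bar>g x\<bar> \<le> K" "\<And>x. \<bar>h x\<bar> \<le> K" for g h
    by (rule bounded_integrable[where K = "K * K"]) (auto simp: abs_mult that K intro!: mult_mono)
  \<comment> \<open>The midpoint lies in the hull, so its \<open>D\<close> is at least
    \<open>d\<close>; the parallelogram identity then bounds the squared \<open>L\<^sup>2\<close>
    distance. The tolerance \<open>(1 / 4) ^ n\<close> makes the resulting distances summable in
    \<open>n\<close>.\<close>
  have close: "(\<integral>x. \<bar>g x - h x\<bar> \<partial>M) \<le> 2 * (1 / 2) ^ n"
    if g: "g \<in> orbit_hull f" "D g \<le> d + (1 / 4) ^ n"
      and h: "h \<in> orbit_hull f" "D h \<le> d + (1 / 4) ^ n" for g h n
  proof -
    note gm = props(1,2)[OF g(1)] and hm = props(1,2)[OF h(1)]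
    note mid = orbit_hull.midpoint[OF g(1) h(1)]
    have int: "integrable M (\<lambda>x. (g x)\<^sup>2)" "integrable M (\<lambda>x. (h x)\<^sup>2)"
      "integrable M (\<lambda>x. ((g x + h x) / 2)\<^sup>2)" "integrable M g" "integrable M h"
      unfolding power2_eq_square
      by (intro bounded_prod bounded_integrable[OF gm] bounded_integrable[OF hm] gm hm props(1,2)[OF mid])+
    have id: "(g x - h x)\<^sup>2 = 2 * (g x)\<^sup>2 + 2 * (h x)\<^sup>2 - 4 * ((g x + h x) / 2)\<^sup>2" for x
      by (simp add: power2_eq_square field_simps)
    have "(\<integral>x. (g x - h x)\<^sup>2 \<partial>M) = 2 * D g + 2 * D h - 4 * D (\<lambda>x. (g x + h x) / 2)"
      unfolding id D_def
      by (subst Bochner_Integration.integral_diff Bochner_Integration.integral_add,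
          (intro Bochner_Integration.integrable_add integrable_mult_right int)+)+
        (simp only: integral_mult_right_zero)
    also have "\<dots> \<le> 4 * (1 / 4) ^ n"
      using g h d_le[OF mid] by simp
    finally have "(\<integral>x. \<bar>g x - h x\<bar> \<partial>M)\<^sup>2 \<le> 4 * (1 / 4) ^ n"
      using L1_le_L2[of "\<lambda>x. g x - h x"] int unfolding id by auto
    also have "4 * (1 / 4) ^ n = (2 * (1 / 2) ^ n :: real)\<^sup>2"
      by (simp add: power2_eq_square mult_ac flip: power_mult_distrib)
    finally show ?thesis
      by (rule power2_le_imp_le) simp
  qed
  have "\<exists>g. g \<in> orbit_hull f \<and> D g \<le> d + (1 / 4) ^ n" for n
  proof -
    have "\<exists>t\<in>D ` orbit_hull f. t < d + (1 / 4) ^ n"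
      unfolding d_def using orbit_hull.base bdd by (intro cInf_lessD) auto
    then show ?thesis by (auto intro: less_imp_le)
  qed
  then obtain g where g: "\<And>n. g n \<in> orbit_hull f" "\<And>n. D (g n) \<le> d + (1 / 4) ^ n"
    by metis
  note [measurable] = props(1)[OF g(1)]
  \<comment> \<open>A shift of \<open>g n\<close> is as near to the infimum as \<open>g n\<close>
    itself, so \<open>close\<close> applies to the pair. This will make the limit invariant.\<close>
  have D_shift: "D (\<lambda>x. g n (sigma_map q x)) = D (g n)" if "q \<in> {2, 3}" for n q
    unfolding D_def by (rule integral_sigma[OF in_S_2_3[OF that]]) measurable
  have int: "integrable M (g n)" for n
    by (rule bounded_integrable[OF props(1,2)[OF g(1)]])
  have summable: "summable (\<lambda>n. 2 * (1 / 2) ^ n :: real)"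
    by (intro summable_mult summable_geometric) simp
  have "AE x in M. summable (\<lambda>n. g (Suc n) x - g n x)"
  proof (rule AE_summable_if_summable_integral)
    have "D (g (Suc n)) \<le> d + (1 / 4) ^ n" for n
      using g(2)[of "Suc n"] by (simp add: field_simps)
    then have "(\<integral>x. \<bar>g (Suc n) x - g n x\<bar> \<partial>M) \<le> 2 * (1 / 2) ^ n" for n
      using g by (intro close) auto
    then show "summable (\<lambda>n. \<integral>x. \<bar>g (Suc n) x - g n x\<bar> \<partial>M)"
      by (intro summable_comparison_test'[OF summable, of 0]) auto
  qed (use int in auto)
  then have conv: "AE x in M. convergent (\<lambda>n. g n x)"
  proof eventually_elim
    case (elim x)
    then have "(\<lambda>n. (g n x - g 0 x) + g 0 x) \<longlonglongrightarrow> (\<Sum>n. g (Suc n) x - g n x) + g 0 x"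
      using summable_LIMSEQ[OF elim] by (intro tendsto_add tendsto_const) (simp add: sum_lessThan_telescope[of "\<lambda>n. g n x"])
    then show ?case
      by (auto intro: convergentI)
  qed
  \<comment> \<open>Where the sequence diverges, \<open>lim\<close> is unspecified; by
    \<open>conv\<close> this happens only on a null set.\<close>
  define h where "h x = lim (\<lambda>n. g n x)" for x
  have [measurable]: "h \<in> borel_measurable M"
    unfolding h_def by (rule borel_measurable_lim_metric) simp
  have lim: "AE x in M. (\<lambda>n. g n x) \<longlonglongrightarrow> h x"
    using conv unfolding h_def by (simp add: convergent_LIMSEQ_iff)
  have inv: "AE x in M. h (sigma_map q x) = h x" if q: "q \<in> {2, 3}" for q
  proof -
    have "AE x in M. summable (\<lambda>n. g n (sigma_map q x) - g n x)"
    proof (rule AE_summable_if_summable_integral)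
      have "(\<integral>x. \<bar>g n (sigma_map q x) - g n x\<bar> \<partial>M) \<le> 2 * (1 / 2) ^ n" for n
        using g q D_shift by (intro close orbit_hull.shift) auto
      then show "summable (\<lambda>n. \<integral>x. \<bar>g n (sigma_map q x) - g n x\<bar> \<partial>M)"
        by (intro summable_comparison_test'[OF summable, of 0]) auto
    qed (use int integrable_sigma[OF in_S_2_3[OF q]] in auto)
    moreover note lim AE_sigma[OF in_S_2_3[OF q] lim]
    ultimately show ?thesis
    proof eventually_elim
      case (elim x)
      have "(\<lambda>n. (g n (sigma_map q x) - g n x) + g n x) \<longlonglongrightarrow> 0 + h x"
        using elim by (intro tendsto_add summable_LIMSEQ_zero)
      then show ?case
        using elim(3) by (simp add: LIMSEQ_unique)
    qed
  qed
  \<comment> \<open>\<open>S_ergodic\<close> speaks of complex-valued functions, so the real limit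
    is embedded first.\<close>
  have "\<exists>c. AE x in M. complex_of_real (h x) = c"
    using erg inv[of 2] inv[of 3] unfolding S_ergodic_def
    by (elim allE[of _ "\<lambda>x. complex_of_real (h x)"]) auto
  then obtain c where c: "AE x in M. complex_of_real (h x) = c" ..
  have lim_c: "AE x in M. (\<lambda>n. g n x) \<longlonglongrightarrow> Re c"
    using lim c by eventually_elim auto
  \<comment> \<open>All \<open>g n\<close> have integral 0 and share the bound \<open>K\<close>, so
    the constant limit must be 0.\<close>
  have "(\<lambda>n. \<integral>x. g n x \<partial>M) \<longlonglongrightarrow> (\<integral>x. Re c \<partial>M)"
    by (rule integral_dominated_convergence[where w = "\<lambda>_. K"])
      (use lim_c props(2)[OF g(1)] in auto)
  then have "Re c = 0"
    using props(3)[OF g(1)] mean by (simp add: prob_space LIMSEQ_const_iff)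
  have "(\<lambda>n. \<integral>x. \<bar>g n x\<bar> \<partial>M) \<longlonglongrightarrow> (\<integral>x. 0 \<partial>M)"
  proof (rule integral_dominated_convergence[where w = "\<lambda>_. K"])
    show "AE x in M. (\<lambda>n. \<bar>g n x\<bar>) \<longlonglongrightarrow> 0"
      using lim_c unfolding \<open>Re c = 0\<close> by eventually_elim (rule tendsto_rabs_zero)
  qed (use props(2)[OF g(1)] in auto)
  then have "\<forall>\<^sub>F n in sequentially. (\<integral>x. \<bar>g n x\<bar> \<partial>M) < \<epsilon>"
    using \<open>0 < \<epsilon>\<close> by (auto dest: order_tendstoD(2))
  then show thesis
    using that[OF g(1)] by (auto simp: eventually_sequentially intro: less_imp_le)
qed

section \<open>Weak type bounds for orbit averages and the Banach principle\<close>

lemma maximal_average: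
  fixes f :: "real \<Rightarrow> real"
  assumes f: "integrable M f" and a: "0 < a"
  obtains E where "E \<in> sets M" "a * measure M E \<le> 256 * (\<integral>x. \<bar>f x\<bar> \<partial>M)"
    "\<And>x N. x \<in> space M - E \<Longrightarrow> (1::nat) \<le> N \<Longrightarrow> \<bar>orbit_average f N x\<bar> < a"
proof -
  \<comment> \<open>The threshold is \<open>a / 16\<close> because the square containing the first
    \<open>N\<close> elements has area at most \<open>16 * N\<close>. Together with the constant 16
    of \<open>maximal_inequality\<close> this yields 256.\<close>
  let ?E = "{x \<in> space M. \<exists>n\<ge>1. a / 16 * (real n)\<^sup>2 \<le> square_sum (\<lambda>x. \<bar>f x\<bar>) n x}"
  have [measurable]: "f \<in> borel_measurable M"
    using f by auto
  show thesis
  proof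
    show "?E \<in> sets M" by measurable
    show "a * measure M ?E \<le> 256 * (\<integral>x. \<bar>f x\<bar> \<partial>M)"
      using maximal_inequality[of "\<lambda>x. \<bar>f x\<bar>" "a / 16"] f a by simp
    fix x and N :: nat assume x: "x \<in> space M - ?E" and N: "1 \<le> N"
    obtain L where L: "1 \<le> L" "L\<^sup>2 \<le> 16 * N" "\<And>m. m \<in> s ` {1..N} \<Longrightarrow> m < 2 ^ L"
      using dyadic_scale[OF N] by blast
    have "\<bar>\<Sum>n=1..N. f (sigma_map (s n) x)\<bar> \<le> (\<Sum>n=1..N. \<bar>f (sigma_map (s n) x)\<bar>)"
      by (rule sum_abs)
    also have "\<dots> \<le> square_sum (\<lambda>x. \<bar>f x\<bar>) L x"
      unfolding square_sum_def by (rule s_sum_le_square) (use L(3) in auto)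
    also have "\<dots> < a / 16 * (real L)\<^sup>2"
      using x L(1) by auto
    also have "\<dots> \<le> a / 16 * (16 * real N)"
      using a of_nat_mono[OF L(2), where 'a=real] by (intro mult_left_mono) auto
    finally show "\<bar>orbit_average f N x\<bar> < a"
      using N by (simp add: orbit_average_def divide_simps)
  qed
qed

text \<open>The averages of \<open>u m\<close> stay below \<open>a\<close> for all
  \<open>N \<ge> 1\<close> outside a set \<open>E m\<close> of measure at most a constant over
  \<open>a * (m + 1)\<close>. The intersection of these sets is null, and a point outside it escapes
  some \<open>E m\<close>; there the averages of \<open>f\<close> are eventually below
  \<open>2 * a\<close>.\<close>

lemma Banach_principle:
  fixes f :: "real \<Rightarrow> real"
  assumes approx: "\<And>\<epsilon>. 0 < \<epsilon> \<Longrightarrow> \<exists>u. integrable M u \<and>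
      (\<integral>x. \<bar>u x\<bar> \<partial>M) \<le> \<epsilon> \<and> (AE x in M. (\<lambda>N. orbit_average (\<lambda>x. f x - u x) N x) \<longlonglongrightarrow> 0)"
  shows "AE x in M. (\<lambda>N. orbit_average f N x) \<longlonglongrightarrow> 0"
proof -
  have "AE x in M. \<forall>\<^sub>F N in sequentially. \<bar>orbit_average f N x\<bar> < 2 * a" if a: "0 < a" for a
  proof -
    define P where "P m u \<longleftrightarrow> integrable M u \<and> (\<integral>x. \<bar>u x\<bar> \<partial>M) \<le> inverse (real (Suc m)) \<and>
        (AE x in M. (\<lambda>N. orbit_average (\<lambda>x. f x - u x) N x) \<longlonglongrightarrow> 0)" for m u
    have "\<exists>u. P m u" for m
      unfolding P_def by (rule approx) simp
    then obtain u where "\<And>m. P m (u m)"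
      by metis
    then have u: "\<And>m. integrable M (u m)"
      "\<And>m. (\<integral>x. \<bar>u m x\<bar> \<partial>M) \<le> inverse (real (Suc m))"
      "\<And>m. AE x in M. (\<lambda>N. orbit_average (\<lambda>x. f x - u m x) N x) \<longlonglongrightarrow> 0"
      by (simp_all add: P_def)
    define Q where "Q m E \<longleftrightarrow> E \<in> sets M \<and> a * measure M E \<le> 256 * (\<integral>x. \<bar>u m x\<bar> \<partial>M) \<and>
        (\<forall>x\<in>space M - E. \<forall>N\<ge>1. \<bar>orbit_average (u m) N x\<bar> < a)" for m E
    have "\<exists>E. Q m E" for m
      unfolding Q_def by (rule maximal_average[OF u(1) a, of m]) blast
    then obtain E where "\<And>m. Q m (E m)"
      by metis
    then have E: "\<And>m. E m \<in> sets M"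
      "\<And>m. a * measure M (E m) \<le> 256 * (\<integral>x. \<bar>u m x\<bar> \<partial>M)"
      "\<And>m x N. x \<in> space M - E m \<Longrightarrow> 1 \<le> N \<Longrightarrow> \<bar>orbit_average (u m) N x\<bar> < a"
      by (simp_all add: Q_def)
    have "a * measure M (\<Inter>m. E m) \<le> 256 * inverse (real (Suc m))" for m
    proof -
      have "measure M (\<Inter>m. E m) \<le> measure M (E m)"
        using E(1) by (intro finite_measure_mono) auto
      then have "a * measure M (\<Inter>m. E m) \<le> a * measure M (E m)"
        using a by simp
      then show ?thesis
        using E(2)[of m] u(2)[of m] by linarith
    qed
    then have "a * measure M (\<Inter>m. E m) \<le> 256 * 0"
      by (intro LIMSEQ_le_const[OF tendsto_mult_left[OF LIMSEQ_inverse_real_of_nat]]) auto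
    then have "measure M (\<Inter>m. E m) = 0"
      using a by (simp add: mult_le_0_iff measure_le_0_iff)
    then have "(\<Inter>m. E m) \<in> null_sets M"
      using E(1) by (auto simp: null_sets_def emeasure_eq_measure)
    then have "AE x in M. x \<notin> (\<Inter>m. E m)"
      by (rule AE_not_in)
    moreover have "AE x in M. \<forall>m. (\<lambda>N. orbit_average (\<lambda>x. f x - u m x) N x) \<longlonglongrightarrow> 0"
      using u(3) by (simp add: AE_all_countable)
    ultimately show ?thesis
      using AE_space
    proof eventually_elim
      case (elim x)
      then obtain m where m: "x \<in> space M - E m" by auto
      have "\<forall>\<^sub>F N in sequentially. \<bar>orbit_average (\<lambda>x. f x - u m x) N x\<bar> < a"
        using order_tendstoD(2)[OF tendsto_rabs_zero, of "\<lambda>N. orbit_average (\<lambda>x. f x - u m x) N x"] elim a by simp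
      then show ?case
        using eventually_ge_at_top[of 1]
      proof eventually_elim
        case (elim N)
        have "orbit_average f N x = orbit_average (u m) N x + orbit_average (\<lambda>x. f x - u m x) N x"
          by (simp add: orbit_average_diff)
        then show ?case
          using E(3)[OF m elim(2)] elim(1) by linarith
      qed
    qed
  qed
  then have "AE x in M. \<forall>k. \<forall>\<^sub>F N in sequentially. \<bar>orbit_average f N x\<bar> < 2 * inverse (real (Suc k))"
    by (simp add: AE_all_countable)
  then show ?thesis
  proof eventually_elim
    case (elim x)
    show ?case
    proof (rule tendstoI)
      fix e :: real assume "0 < e"
      then obtain k where "inverse (real (Suc k)) < e / 2"
        using reals_Archimedean[of "e / 2"] by auto
      then show "\<forall>\<^sub>F N in sequentially. dist (orbit_average f N x) 0 < e"
        using elim[rule_format, of k] by (auto elim!: eventually_mono)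
    qed
  qed
qed

section \<open>From bounded to integrable functions\<close>

lemma bounded_truncation:
  fixes f :: "real \<Rightarrow> real"
  assumes f: "integrable M f" and "0 < \<epsilon>"
  obtains g K where "g \<in> borel_measurable M" "\<And>x. \<bar>g x\<bar> \<le> K" "(\<integral>x. \<bar>f x - g x\<bar> \<partial>M) \<le> \<epsilon>"
proof -
  have [measurable]: "f \<in> borel_measurable M"
    using f by auto
  let ?g = "\<lambda>k x. max (- real k) (min (real k) (f x))"
  have "(\<lambda>k. \<integral>x. \<bar>f x - ?g k x\<bar> \<partial>M) \<longlonglongrightarrow> (\<integral>x. 0 \<partial>M)"
  proof (rule integral_dominated_convergence[where w = "\<lambda>x. \<bar>f x\<bar>"])
    have "(\<lambda>k. \<bar>f x - ?g k x\<bar>) \<longlonglongrightarrow> 0" for x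
    proof (rule tendsto_eventually, rule eventually_sequentiallyI)
      fix k assume "nat \<lceil>\<bar>f x\<bar>\<rceil> \<le> k"
      then have "\<bar>f x\<bar> \<le> real k" by linarith
      then show "\<bar>f x - ?g k x\<bar> = 0" by simp
    qed
    then show "AE x in M. (\<lambda>k. \<bar>f x - ?g k x\<bar>) \<longlonglongrightarrow> 0" by simp
    show "AE x in M. norm \<bar>f x - ?g k x\<bar> \<le> \<bar>f x\<bar>" for k
      by (intro AE_I2) auto
  qed (use f in auto)
  then have "\<forall>\<^sub>F k in sequentially. (\<integral>x. \<bar>f x - ?g k x\<bar> \<partial>M) < \<epsilon>"
    using \<open>0 < \<epsilon>\<close> by (auto dest: order_tendstoD(2))
  then obtain k where "(\<integral>x. \<bar>f x - ?g k x\<bar> \<partial>M) < \<epsilon>"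
    by (auto simp: eventually_sequentially)
  then show thesis
    by (intro that[of "?g k" k]) auto
qed

theorem pointwise_ergodic_real:
  fixes f :: "real \<Rightarrow> real"
  assumes erg: "S_ergodic M" and f: "integrable M f"
  shows "AE x in M. (\<lambda>N. orbit_average f N x) \<longlonglongrightarrow> (\<integral>y. f y \<partial>M)"
proof -
  define c where "c = (\<integral>y. f y \<partial>M)"
  have "AE x in M. (\<lambda>N. orbit_average (\<lambda>x. f x - c) N x) \<longlonglongrightarrow> 0"
  proof (rule Banach_principle)
    fix \<epsilon> :: real assume "0 < \<epsilon>"
    then have "0 < \<epsilon> / 3" by simp
    then obtain g K where g [measurable]: "g \<in> borel_measurable M"
      and K: "\<And>x. \<bar>g x\<bar> \<le> K" and fg: "(\<integral>x. \<bar>f x - g x\<bar> \<partial>M) \<le> \<epsilon> / 3"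
      by (rule bounded_truncation[OF f]) (rule that)
    define b where "b = (\<integral>x. g x \<partial>M)"
    have int_g: "integrable M g"
      using g K by (rule bounded_integrable)
    have meas: "(\<lambda>x. g x - b) \<in> borel_measurable M" by measurable
    have bound: "\<bar>g x - b\<bar> \<le> K + \<bar>b\<bar>" for x
      using K[of x] by linarith
    have "(\<integral>x. g x - b \<partial>M) = 0"
      using int_g by (simp add: b_def prob_space)
    then obtain h where h: "h \<in> orbit_hull (\<lambda>x. g x - b)" "(\<integral>x. \<bar>h x\<bar> \<partial>M) \<le> \<epsilon> / 3"
      using mean_ergodic[OF erg meas bound _ \<open>0 < \<epsilon> / 3\<close>] by metis
    note props = orbit_hull_properties[OF meas bound h(1)]
    have int_h: "integrable M h"
      using props(1,2) by (rule bounded_integrable)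
    have "\<bar>b - c\<bar> = \<bar>\<integral>x. f x - g x \<partial>M\<bar>"
      using f int_g by (simp add: b_def c_def)
    also have "\<dots> \<le> (\<integral>x. \<bar>f x - g x\<bar> \<partial>M)"
      using f int_g by (intro integral_abs_bound)
    finally have bc: "\<bar>b - c\<bar> \<le> \<epsilon> / 3"
      using fg by simp
    \<comment> \<open>With this choice \<open>f x - c - ?u x\<close> equals
      \<open>(g x - b) - h x\<close>, whose averages tend to 0 at every point since \<open>h\<close>
      is in the hull of \<open>g - b\<close>. Each of the three terms contributes at most
      \<open>\<epsilon> / 3\<close> to the norm.\<close>
    let ?u = "\<lambda>x. (f x - g x) + (b - c) + h x"
    have "(\<integral>x. \<bar>?u x\<bar> \<partial>M) \<le> (\<integral>x. \<bar>f x - g x\<bar> + \<bar>b - c\<bar> + \<bar>h x\<bar> \<partial>M)"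
      using f int_g int_h by (intro integral_mono) auto
    also have "\<dots> = (\<integral>x. \<bar>f x - g x\<bar> \<partial>M) + \<bar>b - c\<bar> + (\<integral>x. \<bar>h x\<bar> \<partial>M)"
      using f int_g int_h by (simp add: prob_space)
    finally have "(\<integral>x. \<bar>?u x\<bar> \<partial>M) \<le> \<epsilon>"
      using fg bc h(2) by simp
    moreover have "integrable M ?u"
      using f int_g int_h by auto
    moreover have "(\<lambda>x. f x - c - ?u x) = (\<lambda>x. (g x - b) - h x)" by auto
    then have "AE x in M. (\<lambda>N. orbit_average (\<lambda>x. f x - c - ?u x) N x) \<longlonglongrightarrow> 0"
      using props(4) by (simp only: orbit_average_diff) simp
    ultimately show "\<exists>u. integrable M u \<and> (\<integral>x. \<bar>u x\<bar> \<partial>M) \<le> \<epsilon> \<and>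
        (AE x in M. (\<lambda>N. orbit_average (\<lambda>x. f x - c - u x) N x) \<longlonglongrightarrow> 0)"
      by blast
  qed
  then show ?thesis
  proof eventually_elim
    case (elim x)
    have "(\<lambda>N. orbit_average (\<lambda>x. f x - c) N x + c) \<longlonglongrightarrow> 0 + c"
      using elim by (intro tendsto_intros)
    \<comment> \<open>A constant equals its average only from \<open>N = 1\<close> on.\<close>
    moreover have "\<forall>\<^sub>F N in sequentially. orbit_average (\<lambda>x. f x - c) N x + c = orbit_average f N x"
      using eventually_ge_at_top[of 1]
      by eventually_elim (simp add: orbit_average_diff orbit_average_const)
    ultimately have "(\<lambda>N. orbit_average f N x) \<longlonglongrightarrow> c"
      by (simp cong: filterlim_cong)
    then show ?case
      by (simp add: c_def)
  qed
qed

section \<open>Integrability from L log+ L and passage to complex functions\<close>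

lemma L_log_L_integrable:
  assumes "L_log_L M f"
  shows "integrable M f"
proof (rule integrableI_bounded)
  show f [measurable]: "f \<in> borel_measurable M"
    using assms by (simp add: L_log_L_def)
  \<comment> \<open>Above \<open>exp 1\<close> the logarithm is at least 1; below it the constant
    dominates, and constants are integrable on a probability space.\<close>
  have "norm (f x) \<le> exp 1 + norm (f x) * log_plus (norm (f x))" for x
  proof (cases "norm (f x) \<le> exp 1")
    case True
    then show ?thesis by (auto simp: log_plus_def intro: order_trans)
  next
    case False
    then have "1 \<le> ln (norm (f x))"
      by (subst ln_ge_iff) (auto intro: less_trans[OF exp_gt_zero])
    then have "norm (f x) * 1 \<le> norm (f x) * log_plus (norm (f x))"
      by (intro mult_left_mono) (auto simp: log_plus_def)
    then show ?thesis by (smt (verit) exp_gt_zero)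
  qed
  then have "(\<integral>\<^sup>+ x. ennreal (norm (f x)) \<partial>M)
      \<le> (\<integral>\<^sup>+ x. ennreal (exp 1) + ennreal (norm (f x) * log_plus (norm (f x))) \<partial>M)"
    by (intro nn_integral_mono) (auto simp: log_plus_def simp flip: ennreal_plus intro!: ennreal_leI)
  also have "\<dots> = ennreal (exp 1) + (\<integral>\<^sup>+ x. ennreal (norm (f x) * log_plus (norm (f x))) \<partial>M)"
    unfolding log_plus_def by (subst nn_integral_add) (auto simp: emeasure_space_1[simplified])
  also have "\<dots> < \<infinity>"
    using assms by (simp add: L_log_L_def)
  finally show "(\<integral>\<^sup>+ x. ennreal (norm (f x)) \<partial>M) < \<infinity>" .
qed

theorem pointwise_ergodic:
  fixes f :: "real \<Rightarrow> complex"
  assumes erg: "S_ergodic M" and f: "integrable M f"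
  shows "AE x in M. (\<lambda>N. orbit_average f N x) \<longlonglongrightarrow> (\<integral>y. f y \<partial>M)"
proof -
  have "AE x in M. (\<lambda>N. orbit_average (\<lambda>x. Re (f x)) N x) \<longlonglongrightarrow> (\<integral>y. Re (f y) \<partial>M)"
    "AE x in M. (\<lambda>N. orbit_average (\<lambda>x. Im (f x)) N x) \<longlonglongrightarrow> (\<integral>y. Im (f y) \<partial>M)"
    by (rule pointwise_ergodic_real[OF erg], use f in simp)+
  then show ?thesis
  proof eventually_elim
    case (elim x)
    have "Re (orbit_average f N x) = orbit_average (\<lambda>x. Re (f x)) N x"
      "Im (orbit_average f N x) = orbit_average (\<lambda>x. Im (f x)) N x" for N
      by (simp_all add: orbit_average_def Re_divide_of_nat Im_divide_of_nat)
    then show ?case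
      using elim f by (simp add: tendsto_complex_iff)
  qed
qed

end

section \<open>Weak* convergence of the empirical measures\<close>

text \<open>Reduces weak* convergence to convergence of orbit averages of continuous functions. For
  \<open>N = 0\<close> both sides are 0.\<close>

lemma orbit_average_empirical:
  fixes g :: "real \<Rightarrow> complex"
  assumes "g \<in> borel_measurable circle_borel"
  shows "(\<integral>y. g y \<partial>empirical_measure N x) = orbit_average g N x"
proof -
  have meas: "(\<lambda>n. sigma_map (s n) x) \<in> uniform_count_measure {1..N} \<rightarrow>\<^sub>M circle_borel"
    by (rule measurableI) (auto simp: space_uniform_count_measure sets_uniform_count_measure)
  have "(\<integral>y. g y \<partial>empirical_measure N x)
      = (\<integral>n. g (sigma_map (s n) x) \<partial>point_measure {1..N} (\<lambda>_. ennreal (1 / real N)))"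
    unfolding empirical_measure_def integral_distr[OF meas assms]
    by (simp add: uniform_count_measure_def)
  also have "\<dots> = orbit_average g N x"
    by (subst lebesgue_integral_point_measure_finite)
      (simp_all add: orbit_average_def scaleR_conv_of_real sum_divide_distrib)
  finally show ?thesis .
qed

text \<open>Exactly one of the \<open>m\<close> grid cells contains \<open>y\<close>, and the
  argument of \<open>g\<close> on the left is its left endpoint. All endpoints are rational, so
  countably many intervals will serve every \<open>g\<close>.\<close>

lemma step_function_eq:
  fixes g :: "real \<Rightarrow> 'a::real_algebra_1"
  assumes y: "y \<in> {0..<1}" and m: "0 < m"
  shows "g (of_int \<lfloor>real m * y\<rfloor> / real m)
    = (\<Sum>k<m. g (real k / real m) * of_real (indicator {real k / real m..<real (k + 1) / real m} y))"
proof -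
  define l where "l = nat \<lfloor>real m * y\<rfloor>"
  have pos: "0 \<le> real m * y" "real m * y < real m" using y m by auto
  then have l: "of_int \<lfloor>real m * y\<rfloor> = real l" "l < m"
    by (auto simp: l_def) linarith
  have "indicator {real k / real m..<real (k + 1) / real m} y = (if k = l then 1 else 0 :: real)" for k
  proof -
    have "y \<in> {real k / real m..<real (k + 1) / real m} \<longleftrightarrow> real k \<le> real m * y \<and> real m * y < real k + 1"
      using m by (auto simp: field_simps)
    also have "\<dots> \<longleftrightarrow> \<lfloor>real m * y\<rfloor> = int k"
      by (simp add: floor_eq_iff)
    also have "\<dots> \<longleftrightarrow> k = l"
      using pos by (auto simp: l_def)
    finally show ?thesis
      by (simp only: indicator_def of_bool_def)
  qed
  then have "(\<Sum>k<m. g (real k / real m) * of_real (indicator {real k / real m..<real (k + 1) / real m} y))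
      = (\<Sum>k<m. if k = l then g (real k / real m) else 0)"
    by (intro sum.cong) auto
  then show ?thesis
    using l by simp
qed

text \<open>Uniform continuity on the compact interval: a point is less than \<open>1 / m\<close>
  away from the left endpoint of its cell.\<close>

lemma circle_continuous_step_approx:
  assumes g: "circle_continuous g" and "0 < \<epsilon>"
  obtains m where "0 < m"
    "\<And>y. y \<in> {0..<1} \<Longrightarrow> norm (g y - g (of_int \<lfloor>real m * y\<rfloor> / real m)) \<le> \<epsilon>"
proof -
  have "continuous_on {0..1} g"
    using g by (auto simp: circle_continuous_def intro: continuous_on_subset)
  then have "uniformly_continuous_on {0..1} g"
    by (rule compact_uniformly_continuous) simp
  then obtain \<delta> where \<delta>: "0 < \<delta>"
    "\<And>y z. y \<in> {0..1} \<Longrightarrow> z \<in> {0..1} \<Longrightarrow> dist z y < \<delta> \<Longrightarrow> dist (g z) (g y) < \<epsilon>"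
    using \<open>0 < \<epsilon>\<close> unfolding uniformly_continuous_on_def by metis
  obtain k where k: "inverse (real (Suc k)) < \<delta>"
    using reals_Archimedean[OF \<delta>(1)] by auto
  define m where "m = Suc k"
  have "norm (g y - g (of_int \<lfloor>real m * y\<rfloor> / real m)) \<le> \<epsilon>" if y: "y \<in> {0..<1}" for y
  proof -
    define z :: real where "z = of_int \<lfloor>real m * y\<rfloor> / real m"
    have m: "0 < real m" by (simp add: m_def)
    have "z \<le> real m * y / real m" "(real m * y - 1) / real m < z"
      unfolding z_def using m by (intro divide_right_mono divide_strict_right_mono; linarith)+
    then have z: "z \<le> y" "y - 1 / real m < z"
      using m by (simp_all add: diff_divide_distrib)
    moreover have "0 \<le> z"
      using y m by (auto simp: z_def)
    moreover have "1 / real m < \<delta>"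
      using k by (simp add: m_def inverse_eq_divide)
    ultimately have "dist (g y) (g z) < \<epsilon>"
      using y by (intro \<delta>(2)) (auto simp: dist_real_def)
    then show ?thesis
      by (simp add: dist_norm z_def)
  qed
  then show thesis
    by (intro that[of m]) (simp_all add: m_def)
qed

lemma indicator_Ico_circle_measurable:
  "(indicator {a..<b} :: real \<Rightarrow> real) \<in> borel_measurable circle_borel"
  unfolding circle_borel_def by (intro measurable_restrict_space1) simp

lemma circle_continuous_measurable:
  "circle_continuous g \<Longrightarrow> g \<in> borel_measurable circle_borel"
  unfolding circle_continuous_def circle_borel_def
  by (intro measurable_restrict_space1 borel_measurable_continuous_onI) simp

context S_system
begin

lemma circle_borel_measurable: "borel_measurable circle_borel = borel_measurable M"
  by (rule measurable_cong_sets) (simp_all add: sets_M)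

lemma indicator_Ico_measurable [measurable]:
  "(indicator {a..<b} :: real \<Rightarrow> real) \<in> borel_measurable M"
  using indicator_Ico_circle_measurable by (simp only: circle_borel_measurable)

lemma integrable_indicator_Ico: "integrable M (indicator {a..<b} :: real \<Rightarrow> real)"
  by (rule bounded_integrable[OF indicator_Ico_measurable, where K = 1]) (simp add: indicator_def)

text \<open>One null set must work for all continuous functions at once. The pointwise theorem is
  used only for intervals with rational endpoints, which are countable; a continuous function is
  then uniformly approximated by steps on a rational grid.\<close>

lemma weak_star_limit:
  assumes erg: "S_ergodic M"
  shows "AE x in M. weak_star_tendsto (\<lambda>N. empirical_measure N x) M"
proof -
  have "AE x in M. \<forall>p\<in>\<rat> \<times> \<rat>. (\<lambda>N. orbit_average (indicator {fst p..<snd p}) N x)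
      \<longlonglongrightarrow> (\<integral>y. indicator {fst p..<snd p} y \<partial>M :: real)"
    using countable_rat
    by (intro AE_ball_countable[THEN iffD2] countable_SIGMA ballI pointwise_ergodic_real[OF erg]
        integrable_indicator_Ico)
  then show ?thesis
  proof eventually_elim
    case (elim x)
    show ?case
      unfolding weak_star_tendsto_def
    proof (intro allI impI)
      fix g assume g: "circle_continuous g"
      have meas [measurable]: "g \<in> borel_measurable M"
        using circle_continuous_measurable[OF g] by (simp add: circle_borel_measurable)
      have "(\<lambda>N. orbit_average g N x) \<longlonglongrightarrow> (\<integral>y. g y \<partial>M)"
      proof (rule tendstoI)
        fix e :: real assume "0 < e"
        then have "0 < e / 4" by simp
        then obtain m where m: "0 < m" and
          approx: "\<And>y. y \<in> {0..<1} \<Longrightarrow> norm (g y - g (of_int \<lfloor>real m * y\<rfloor> / real m)) \<le> e / 4"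
          by (rule circle_continuous_step_approx[OF g]) (rule that)
        let ?I = "\<lambda>k. {real k / real m..<real (k + 1) / real m}"
        define h where "h y = (\<Sum>k<m. g (real k / real m) * complex_of_real (indicator (?I k) y))" for y
        have gh: "norm (g y - h y) \<le> e / 4" if "y \<in> {0..<1}" for y
          using approx[OF that] step_function_eq[OF that m, of g] by (simp add: h_def)
        have int_h: "integrable M h"
          unfolding h_def by (intro Bochner_Integration.integrable_sum integrable_mult_right integrable_of_real
              integrable_indicator_Ico)
        have int_gh: "integrable M (\<lambda>y. g y - h y)"
        proof (rule integrable_const_bound[where B = "e / 4"])
          show "AE y in M. norm (g y - h y) \<le> e / 4"
            by (intro AE_I2 gh) simp
        qed (use int_h in auto)
        have int_g: "integrable M g"
          using Bochner_Integration.integrable_add[OF int_gh int_h] by simp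
        have average_h: "orbit_average h N x
            = (\<Sum>k<m. g (real k / real m) * complex_of_real (orbit_average (indicator (?I k)) N x))" for N
          unfolding orbit_average_def h_def
          by (subst sum.swap) (simp add: sum_divide_distrib sum_distrib_left)
        have integral_h: "(\<integral>y. h y \<partial>M)
            = (\<Sum>k<m. g (real k / real m) * complex_of_real (\<integral>y. indicator (?I k) y \<partial>M))"
          unfolding h_def
          by (subst Bochner_Integration.integral_sum)
            (auto intro!: integrable_mult_right integrable_of_real integrable_indicator_Ico
              simp del: integral_indicator)
        have rational: "real k / real m \<in> \<rat>" "real (k + 1) / real m \<in> \<rat>" for k
          by (auto intro!: Rats_divide)
        have "(\<lambda>N. orbit_average h N x) \<longlonglongrightarrow> (\<integral>y. h y \<partial>M)"
          unfolding average_h integral_h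
        proof (intro tendsto_sum tendsto_mult tendsto_const tendsto_of_real)
          fix k
          show "(\<lambda>N. orbit_average (indicator (?I k)) N x) \<longlonglongrightarrow> (\<integral>y. indicator (?I k) y \<partial>M :: real)"
            using elim[rule_format, of "(real k / real m, real (k + 1) / real m)"] rational by simp
        qed
        then have "\<forall>\<^sub>F N in sequentially. dist (orbit_average h N x) (\<integral>y. h y \<partial>M) < e / 4"
          using \<open>0 < e / 4\<close> by (rule tendstoD)
        then show "\<forall>\<^sub>F N in sequentially. dist (orbit_average g N x) (\<integral>y. g y \<partial>M) < e"
          using eventually_ge_at_top[of 1]
        proof eventually_elim
          case (elim N)
          have "norm (\<Sum>n=1..N. g (sigma_map (s n) x) - h (sigma_map (s n) x)) \<le> of_nat (card {1..N}) * (e / 4)"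
            by (rule sum_norm_bound) (use gh in auto)
          then have "norm (orbit_average (\<lambda>y. g y - h y) N x) \<le> e / 4"
            using elim(2) by (simp add: orbit_average_def norm_divide field_simps)
          then have "dist (orbit_average g N x) (orbit_average h N x) \<le> e / 4"
            by (simp add: orbit_average_diff dist_norm)
          moreover have "dist (\<integral>y. h y \<partial>M) (\<integral>y. g y \<partial>M) \<le> e / 4"
          proof -
            have "norm (\<integral>y. g y - h y \<partial>M) \<le> (\<integral>y. norm (g y - h y) \<partial>M)"
              by (rule integral_norm_bound)
            also have "\<dots> \<le> (\<integral>y. e / 4 \<partial>M)"
              using int_gh gh by (intro integral_mono) auto
            finally show ?thesis
              using int_g int_h by (simp add: dist_norm norm_minus_commute)
          qed
          ultimately show ?case
            using elim(1) \<open>0 < e\<close> dist_triangle[of "orbit_average g N x" "\<integral>y. g y \<partial>M" "orbit_average h N x"]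
              dist_triangle[of "orbit_average h N x" "\<integral>y. g y \<partial>M" "\<integral>y. h y \<partial>M"] by linarith
        qed
      qed
      then show "(\<lambda>N. \<integral>y. g y \<partial>empirical_measure N x) \<longlonglongrightarrow> (\<integral>y. g y \<partial>M)"
        by (simp add: orbit_average_empirical[OF circle_continuous_measurable[OF g]])
    qed
  qed
qed

end

section \<open>Non-equidistributed points\<close>

lemma frequency_eq_orbit_average:
  "real (card {n \<in> {1..N}. frac (real (s n) * x) \<in> A}) / real N = orbit_average (indicator A) N x"
  by (simp add: orbit_average_def indicator_def sigma_map_def sum_of_bool_eq Int_def)

lemma orbit_average_Ico:
  assumes "0 \<le> a" "a \<le> b"
  shows "orbit_average (indicator {a..<b} :: real \<Rightarrow> real) N x
    = orbit_average (indicator {0..<b}) N x - orbit_average (indicator {0..<a}) N x"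
proof -
  have "(indicator {a..<b} :: real \<Rightarrow> real) = (\<lambda>y. indicator {0..<b} y - indicator {0..<a} y)"
    by (rule ext) (use assms in \<open>auto simp: indicator_def\<close>)
  then show ?thesis
    by (simp add: orbit_average_diff)
qed

lemma orbit_average_mono:
  fixes f g :: "real \<Rightarrow> real"
  assumes "\<And>x. f x \<le> g x"
  shows "orbit_average f N x \<le> orbit_average g N x"
  unfolding orbit_average_def by (intro divide_right_mono sum_mono assms) simp

text \<open>The frequencies are monotone in the endpoint and the limit is continuous in it, so
  convergence at rationals squeezes the frequency at any \<open>c\<close>. Only countably many
  conditions remain, which yields measurability of \<open>W\<close>.\<close>

lemma not_in_W_iff:
  assumes "x \<in> {0..<1}"
  shows "x \<notin> W \<longleftrightarrow>
    (\<forall>c\<in>\<rat> \<inter> {0..1}. (\<lambda>N. orbit_average (indicator {0..<c}) N x) \<longlonglongrightarrow> c)"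
    (is "_ \<longleftrightarrow> (\<forall>c\<in>_. ?F c \<longlonglongrightarrow> c)")
proof -
  have W: "x \<notin> W \<longleftrightarrow> (\<forall>a b. 0 \<le> a \<and> a < b \<and> b \<le> 1 \<longrightarrow>
      (\<lambda>N. orbit_average (indicator {a..<b}) N x) \<longlonglongrightarrow> b - a)"
    using assms by (simp only: W_def equidistributed_mod1_def frequency_eq_orbit_average mem_Collect_eq) blast
  show ?thesis
  proof
    assume "x \<notin> W"
    show "\<forall>c\<in>\<rat> \<inter> {0..1}. ?F c \<longlonglongrightarrow> c"
    proof
      fix c :: real assume c: "c \<in> \<rat> \<inter> {0..1}"
      show "?F c \<longlonglongrightarrow> c"
      proof (cases "c = 0")
        case True
        then show ?thesis by (simp add: orbit_average_def)
      next
        case False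
        then show ?thesis
          using \<open>x \<notin> W\<close> c unfolding W by (elim allE[of _ 0] allE[of _ c]) auto
      qed
    qed
  next
    assume rat: "\<forall>c\<in>\<rat> \<inter> {0..1}. ?F c \<longlonglongrightarrow> c"
    have lim: "?F c \<longlonglongrightarrow> c" if c: "c \<in> {0..1}" for c
    proof (rule tendstoI)
      fix e :: real assume "0 < e"
      \<comment> \<open>The rational neighbours must stay in \<open>{0..1}\<close>, so the endpoints
        0 and 1 approximate themselves.\<close>
      obtain p where p: "p \<in> \<rat> \<inter> {0..1}" "c - e / 2 \<le> p" "p \<le> c"
      proof (cases "c = 0")
        case True
        then show thesis using that[of 0] \<open>0 < e\<close> by auto
      next
        case False
        then obtain p where "p \<in> \<rat>" "max 0 (c - e / 2) < p" "p < c"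
          using Rats_dense_in_real[of "max 0 (c - e / 2)" c] c \<open>0 < e\<close> by auto
        then show thesis using that[of p] c by auto
      qed
      obtain q where q: "q \<in> \<rat> \<inter> {0..1}" "q \<le> c + e / 2" "c \<le> q"
      proof (cases "c = 1")
        case True
        then show thesis using that[of 1] \<open>0 < e\<close> by auto
      next
        case False
        then obtain q where "q \<in> \<rat>" "c < q" "q < min 1 (c + e / 2)"
          using Rats_dense_in_real[of c "min 1 (c + e / 2)"] c \<open>0 < e\<close> by auto
        then show thesis using that[of q] c by auto
      qed
      have "\<forall>\<^sub>F N in sequentially. dist (?F p N) p < e / 2"
        "\<forall>\<^sub>F N in sequentially. dist (?F q N) q < e / 2"
        using tendstoD[OF bspec[OF rat p(1)]] tendstoD[OF bspec[OF rat q(1)]] \<open>0 < e\<close>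
        by (metis half_gt_zero)+
      then show "\<forall>\<^sub>F N in sequentially. dist (?F c N) c < e"
      proof eventually_elim
        case (elim N)
        have "?F p N \<le> ?F c N" "?F c N \<le> ?F q N"
          using p(3) q(3) by (auto intro!: orbit_average_mono simp: indicator_def)
        with elim p(2) q(2) show ?case
          unfolding dist_real_def by linarith
      qed
    qed
    show "x \<notin> W"
      unfolding W
    proof (intro allI impI)
      fix a b :: real assume "0 \<le> a \<and> a < b \<and> b \<le> 1"
      then show "(\<lambda>N. orbit_average (indicator {a..<b}) N x) \<longlonglongrightarrow> b - a"
        by (subst orbit_average_Ico) (auto intro!: tendsto_diff lim)
    qed
  qed
qed

section \<open>Measurability and invariance of \<open>W\<close>\<close>

lemma orbit_average_measurable:
  fixes f :: "real \<Rightarrow> real"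
  assumes "f \<in> borel_measurable circle_borel"
  shows "orbit_average f N \<in> borel_measurable circle_borel"
  unfolding orbit_average_def
  by (intro borel_measurable_divide borel_measurable_sum borel_measurable_const
      measurable_compose[OF measurable_sigma_map assms])

lemma W_measurable: "W \<in> sets circle_borel"
proof -
  have "W = (\<Union>c\<in>\<rat> \<inter> {0..1}. space circle_borel -
      {x \<in> space circle_borel. (\<lambda>N. orbit_average (indicator {0..<c}) N x) \<longlonglongrightarrow> c})"
    using not_in_W_iff by (auto simp: W_def)
  also have "\<dots> \<in> sets circle_borel"
  proof (rule sets.countable_UN'')
    show "countable (\<rat> \<inter> {0..1::real})"
      using countable_rat by blast
    fix c :: real
    note [measurable] = orbit_average_measurable[OF indicator_Ico_circle_measurable]
    show "space circle_borel -
        {x \<in> space circle_borel. (\<lambda>N. orbit_average (indicator {0..<c}) N x) \<longlonglongrightarrow> c}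
        \<in> sets circle_borel"
      by (intro sets.Diff sets.top) measurable
  qed
  finally show ?thesis .
qed

text \<open>The averages of an indicator at \<open>x\<close> and at \<open>sigma_map q x\<close>
  differ by a null sequence, so both points have the same limiting frequencies.\<close>

lemma sigma_map_W_iff:
  assumes x: "x \<in> {0..<1}" and q: "q \<in> {2, 3}"
  shows "sigma_map q x \<in> W \<longleftrightarrow> x \<in> W"
proof -
  have "(\<lambda>N. orbit_average (indicator {0..<c}) N (sigma_map q x)) \<longlonglongrightarrow> c \<longleftrightarrow>
      (\<lambda>N. orbit_average (indicator {0..<c}) N x) \<longlonglongrightarrow> c" for c :: real
  proof -
    have "(\<lambda>N. orbit_average (indicator {0..<c} :: real \<Rightarrow> real) N x -
        orbit_average (\<lambda>x. indicator {0..<c} (sigma_map q x)) N x) \<longlonglongrightarrow> 0"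
      by (rule orbit_average_shift_tendsto_0[where K = 1]) (use q in \<open>auto simp: indicator_def\<close>)
    moreover have "orbit_average (\<lambda>x. indicator {0..<c} (sigma_map q x)) N x
        = (orbit_average (indicator {0..<c}) N (sigma_map q x) :: real)" for N
      by (simp add: orbit_average_def sigma_map_sigma_map mult.commute)
    ultimately have lim: "(\<lambda>N. orbit_average (indicator {0..<c}) N x -
        orbit_average (indicator {0..<c}) N (sigma_map q x)) \<longlonglongrightarrow> (0 :: real)"
      by simp
    show ?thesis
      using Lim_transform[OF _ lim] Lim_transform2[OF _ lim] by blast
  qed
  then show ?thesis
    using not_in_W_iff[OF x] not_in_W_iff[of "sigma_map q x"] by auto
qed

section \<open>Lebesgue measure is determined by the masses of intervals\<close>

lemma circle_measure_eq_lebesgue: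
  assumes M: "prob_space M" "sets M = sets circle_borel"
    and Ico: "\<And>a b. 0 \<le> a \<Longrightarrow> a < b \<Longrightarrow> b \<le> 1 \<Longrightarrow> measure M {a..<b} = b - a"
  shows "M = circle_lebesgue"
proof -
  interpret prob_space M by fact
  have circle: "{0..<1::real} \<in> sets borel" by simp
  have sets_L: "sets circle_lebesgue = sets circle_borel"
    by (simp add: circle_lebesgue_def circle_borel_def sets_restrict_space)
  have id: "(\<lambda>x. x) \<in> N \<rightarrow>\<^sub>M borel" if "sets N = sets circle_borel" for N :: "real measure"
    unfolding measurable_cong_sets[OF that refl] circle_borel_def by (intro measurable_restrict_space1) simp
  have emeasure_L: "emeasure circle_lebesgue A = emeasure lborel A"
    if "A \<subseteq> {0..<1}" for A
    unfolding circle_lebesgue_def by (rule emeasure_restrict_space) (use that in auto)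
  \<comment> \<open>Both measures are transported to the line, where half-open intervals are an
    intersection-stable generator of the Borel sets.\<close>
  have "distr M borel (\<lambda>x. x) = distr circle_lebesgue borel (\<lambda>x. x)"
  proof (rule measure_eqI_generator_eq)
    show "Int_stable (range (\<lambda>(a, b). {a..<b::real}))"
      by (force simp: Int_stable_def)
    fix X assume "X \<in> range (\<lambda>(a, b). {a..<b::real})"
    then obtain a b where X: "X = {a..<b}" by auto
    \<comment> \<open>Cutting down to the circle leaves either an interval covered by
      \<open>Ico\<close> or the empty set.\<close>
    have eq: "{a..<b} \<inter> {0..<1} = {max a 0..<min b 1}" by auto
    have "emeasure M ({a..<b} \<inter> {0..<1}) = emeasure circle_lebesgue ({a..<b} \<inter> {0..<1})"
      unfolding eq using Ico[of "max a 0" "min b 1"]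
      by (cases "max a 0 < min b 1") (auto simp: emeasure_L emeasure_eq_measure)
    then show "emeasure (distr M borel (\<lambda>x. x)) X = emeasure (distr circle_lebesgue borel (\<lambda>x. x)) X"
      using sets_eq_imp_space_eq[OF M(2)] sets_eq_imp_space_eq[OF sets_L]
      by (simp add: emeasure_distr id M(2) sets_L X)
  next
    show "sets (distr M borel (\<lambda>x. x)) = sigma_sets UNIV (range (\<lambda>(a, b). {a..<b::real}))"
      "sets (distr circle_lebesgue borel (\<lambda>x. x)) = sigma_sets UNIV (range (\<lambda>(a, b). {a..<b::real}))"
      by (simp_all add: borel_eq_atLeastLessThan)
    show "range (\<lambda>i::nat. {- real i..<real i}) \<subseteq> range (\<lambda>(a, b). {a..<b::real})"
      by auto
    show "(\<Union>i. {- real i..<real i}) = UNIV"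
    proof (intro UNIV_eq_I[symmetric])
      fix x :: real
      obtain n where "\<bar>x\<bar> < real n" using reals_Archimedean2 by blast
      then show "x \<in> (\<Union>i. {- real i..<real i})" by (auto intro!: exI[of _ n])
    qed
    show "emeasure (distr M borel (\<lambda>x. x)) {- real i..<real i} \<noteq> \<infinity>" for i
      by (simp add: emeasure_distr id M(2) emeasure_eq_measure)
  qed simp
  then have eq: "emeasure (distr M borel (\<lambda>x. x)) A = emeasure (distr circle_lebesgue borel (\<lambda>x. x)) A" for A
    by simp
  show ?thesis
  proof (rule measure_eqI)
    show "sets M = sets circle_lebesgue"
      by (simp add: M(2) sets_L)
    fix A assume "A \<in> sets M"
    then have A: "A \<in> sets borel" "A \<inter> {0..<1} = A"
      unfolding M(2) circle_borel_def by (auto simp: sets_restrict_space)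
    then show "emeasure M A = emeasure circle_lebesgue A"
      using eq[of A] sets_eq_imp_space_eq[OF M(2)] sets_eq_imp_space_eq[OF sets_L]
      by (simp add: emeasure_distr id M(2) sets_L)
  qed
qed

section \<open>Conditioning an invariant measure on \<open>W\<close>\<close>

context S_system
begin

lemma integral_orbit_average:
  fixes f :: "real \<Rightarrow> real"
  assumes f: "integrable M f" and N: "1 \<le> N"
  shows "(\<integral>x. orbit_average f N x \<partial>M) = (\<integral>x. f x \<partial>M)"
  unfolding orbit_average_def
  using N f by (simp add: integrable_sigma integral_sigma s_in_S)

text \<open>If almost every orbit were equidistributed, integrating the frequencies would give \<open>M\<close> the
  same interval masses as Lebesgue measure.\<close>

lemma lebesgue_if_null_W:
  assumes "emeasure M W = 0"
  shows "M = circle_lebesgue"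
proof (rule circle_measure_eq_lebesgue[OF prob_space_axioms sets_M])
  fix a b :: real assume ab: "0 \<le> a" "a < b" "b \<le> 1"
  note [measurable] = orbit_average_measurable[OF indicator_Ico_circle_measurable,
      unfolded circle_borel_measurable]
  have "W \<in> null_sets M"
    using assms W_measurable sets_M by (simp add: null_sets_def)
  then have "AE x in M. x \<notin> W"
    by (rule AE_not_in)
  then have "AE x in M. (\<lambda>N. orbit_average (indicator {a..<b}) N x) \<longlonglongrightarrow> b - a"
    using AE_space
  proof eventually_elim
    case (elim x)
    then show ?case
      using ab by (simp only: W_def equidistributed_mod1_def frequency_eq_orbit_average) simp
  qed
  then have "(\<lambda>N. \<integral>x. orbit_average (indicator {a..<b}) N x \<partial>M) \<longlonglongrightarrow> (\<integral>x. b - a \<partial>M)"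
  proof (intro integral_dominated_convergence[where w = "\<lambda>_. 1"])
    fix N
    have "0 \<le> orbit_average (indicator {a..<b} :: real \<Rightarrow> real) N x"
      "orbit_average (indicator {a..<b} :: real \<Rightarrow> real) N x \<le> 1" for x
      using orbit_average_mono[of "indicator {a..<b}" "\<lambda>_. 1" N x]
        orbit_average_const[of N "1 :: real" x]
      by (cases "N = 0"; auto simp: orbit_average_def indicator_def intro!: sum_nonneg divide_nonneg_nonneg)+
    then show "AE x in M. norm (orbit_average (indicator {a..<b} :: real \<Rightarrow> real) N x) \<le> 1"
      by auto
  qed auto
  moreover have "\<forall>\<^sub>F N in sequentially.
      (\<integral>x. orbit_average (indicator {a..<b}) N x \<partial>M) = measure M ({a..<b} \<inter> space M)"
    using eventually_ge_at_top[of 1]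
    by eventually_elim (simp add: integral_orbit_average[OF integrable_indicator_Ico])
  ultimately have "(\<lambda>N :: nat. measure M ({a..<b} \<inter> space M)) \<longlonglongrightarrow> b - a"
    by (simp cong: filterlim_cong)
  moreover have "{a..<b} \<inter> space M = {a..<b}"
    using ab by auto
  ultimately show "measure M {a..<b} = b - a"
    by (simp add: LIMSEQ_const_iff)
qed

text \<open>Because \<open>W\<close> contains \<open>sigma_map q x\<close> exactly when it contains
  \<open>x\<close>, intersecting with \<open>W\<close> commutes with preimages, and the normalised
  restriction to \<open>W\<close> inherits invariance.\<close>

lemma conditioned_on_W:
  assumes "emeasure M W \<noteq> 0"
  defines "\<nu> \<equiv> uniform_measure M W"
  shows "circle_prob \<nu>" "S_invariant \<nu>" "emeasure \<nu> W = 1"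
proof -
  have W [measurable]: "W \<in> sets M"
    using W_measurable by (simp add: sets_M)
  have fin: "emeasure M W \<noteq> \<infinity>"
    by simp
  show "circle_prob \<nu>"
    using assms fin by (simp add: circle_prob_def prob_space_uniform_measure sets_M)
  show "emeasure \<nu> W = 1"
    using assms(1) by (simp add: \<nu>_def emeasure_eq_measure divide_ennreal measure_nonneg less_le)
  have "distr \<nu> circle_borel (sigma_map q) = \<nu>" if q: "q \<in> {2, 3}" for q
  proof (rule measure_eqI)
    show "sets (distr \<nu> circle_borel (sigma_map q)) = sets \<nu>"
      by (simp add: \<nu>_def sets_M)
    fix A assume "A \<in> sets (distr \<nu> circle_borel (sigma_map q))"
    then have A [measurable]: "A \<in> sets M"
      by (simp add: sets_M)
    have pre: "sigma_map q -` A \<inter> space M \<in> sets M"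
      by measurable
    have sigma_\<nu>: "sigma_map q \<in> \<nu> \<rightarrow>\<^sub>M circle_borel"
      using measurable_sigma_map measurable_cong_sets[of \<nu> circle_borel circle_borel circle_borel]
      by (simp add: \<nu>_def sets_M)
    have "emeasure (distr \<nu> circle_borel (sigma_map q)) A
        = emeasure M (W \<inter> (sigma_map q -` A \<inter> space M)) / emeasure M W"
      using A pre sigma_\<nu> by (simp add: emeasure_distr sets_M[symmetric]) (simp add: \<nu>_def)
    also have "W \<inter> (sigma_map q -` A \<inter> space M) = sigma_map q -` (W \<inter> A) \<inter> space M"
      using sigma_map_W_iff[OF _ q] by (auto simp: W_def)
    also have "emeasure M (sigma_map q -` (W \<inter> A) \<inter> space M) = emeasure (distr M M (sigma_map q)) (W \<inter> A)"
      by (simp add: emeasure_distr del: space_M)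
    also have "\<dots> = emeasure M (W \<inter> A)"
      by (simp add: distr_sigma[OF in_S_2_3[OF q]])
    finally show "emeasure (distr \<nu> circle_borel (sigma_map q)) A = emeasure \<nu> A"
      by (simp add: \<nu>_def)
  qed
  then show "S_invariant \<nu>"
    by (simp add: S_invariant_def)
qed

end

theorem theorem2p13:
  "(\<forall>\<mu>. circle_prob \<mu> \<and> S_invariant \<mu> \<and> S_ergodic \<mu> \<longrightarrow>
      (\<forall>f. L_log_L \<mu> f \<longrightarrow>
        (AE x in \<mu>. (\<lambda>N. (\<Sum>n = 1..N. f (sigma_map (s n) x)) / of_nat N)
                       \<longlonglongrightarrow> (\<integral>y. f y \<partial>\<mu>)))
    \<and> (AE x in \<mu>. weak_star_tendsto (\<lambda>N. empirical_measure N x) \<mu>))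
   \<and> (\<not> furstenberg_conjecture \<longrightarrow>
        (\<exists>\<mu>. circle_prob \<mu> \<and> S_invariant \<mu> \<and> emeasure \<mu> W = 1))"
proof (intro conjI allI impI)
  have system: "S_system \<mu>" if "circle_prob \<mu>" "S_invariant \<mu>" for \<mu>
    using that by (simp add: S_system_def S_system_axioms_def circle_prob_def)
  {
    fix \<mu> assume \<mu>: "circle_prob \<mu> \<and> S_invariant \<mu> \<and> S_ergodic \<mu>"
    then interpret S_system \<mu> by (simp add: system)
    show "AE x in \<mu>. weak_star_tendsto (\<lambda>N. empirical_measure N x) \<mu>"
      using \<mu> by (simp add: weak_star_limit)
    fix f assume "L_log_L \<mu> f"
    then show "AE x in \<mu>. (\<lambda>N. (\<Sum>n = 1..N. f (sigma_map (s n) x)) / of_nat N)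
        \<longlonglongrightarrow> (\<integral>y. f y \<partial>\<mu>)"
      using \<mu> pointwise_ergodic[OF _ L_log_L_integrable] by (simp add: orbit_average_def)
  }
  assume "\<not> furstenberg_conjecture"
  then obtain \<mu> where \<mu>: "circle_prob \<mu>" "S_invariant \<mu>" "\<mu> \<noteq> circle_lebesgue"
    by (auto simp: furstenberg_conjecture_def)
  then interpret S_system \<mu> by (simp add: system)
  show "\<exists>\<mu>. circle_prob \<mu> \<and> S_invariant \<mu> \<and> emeasure \<mu> W = 1"
    \<comment> \<open>Since \<mu> is not Lebesgue measure, \<open>W\<close> is not null for it and
      conditioning is legitimate.\<close>
    using conditioned_on_W lebesgue_if_null_W \<mu>(3) by blast
qed

end
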